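(* Let $\mathscr{A}$ be a unital $C^*$-algebra, let $\mathscr{B}$ be a $C^*$-subalgebra of $\mathscr{A}$ containing the unit of $\mathscr{A}$, and let the positive linear map $\Phi: \mathscr{A} \to \mathscr{B}$ be a unital left multiplier. If $M_1, m_1, M_2, m_2 \in \mathbb{C}$ and $A,B\in \mathscr{A}$ satisfy $$\mathrm{Re}\left((M_1-A)^*(A-m_1)\right)\geq 0 \quad \text{and} \quad \mathrm{Re}\left((M_2-B)^*(B-m_2)\right)\geq 0,$$ then $$\left| \Phi(A^*B)-\Phi(A)^* \Phi(B)\right| \leq \frac{1}{4}\, |M_1-m_1| \, |M_2-m_2|.$$
   Context: A linear map between $C^*$-algebras is positive if it maps positive elements to positive elements, and unital if it preserves the identity. A positive linear map $\Phi : \mathscr{A} \to \mathscr{B}$, where $\mathscr{B}$ is a $C^*$-subalgebra of $\mathscr{A}$, is called a left multiplier if $\Phi(XY)=\Phi(X)Y$ for every $X\in \mathscr{A}$, $Y\in \mathscr{B}$. A complex scalar $\alpha$ also denotes $\alpha$ times the identity. For an element $X$ of a $C^*$-algebra, $|X|=(X^*X)^{1/2}$ and $\mathrm{Re}(X)=\frac12(X+X^* )$; $\le$ is the usual order on self-adjoint elements. *)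

theory Defs
  imports "HOL-Analysis.Analysis"
begin

class cstar_algebra = real_normed_algebra + banach +
  fixes scaleC :: "complex \<Rightarrow> 'a \<Rightarrow> 'a" (infixr "*\<^sub>C" 75)
    and star :: "'a \<Rightarrow> 'a"
  assumes scaleR_scaleC: "r *\<^sub>R x = complex_of_real r *\<^sub>C x"
    and scaleC_add_right: "c *\<^sub>C (x + y) = c *\<^sub>C x + c *\<^sub>C y"
    and scaleC_add_left: "(c + d) *\<^sub>C x = c *\<^sub>C x + d *\<^sub>C x"
    and scaleC_scaleC: "c *\<^sub>C (d *\<^sub>C x) = (c * d) *\<^sub>C x"
    and mult_scaleC_left: "(c *\<^sub>C x) * y = c *\<^sub>C (x * y)"
    and mult_scaleC_right: "x * (c *\<^sub>C y) = c *\<^sub>C (x * y)"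
    and norm_scaleC: "norm (c *\<^sub>C x) = cmod c * norm x"
    and star_star: "star (star x) = x"
    and star_add: "star (x + y) = star x + star y"
    and star_scaleC: "star (c *\<^sub>C x) = cnj c *\<^sub>C star x"
    and star_mult: "star (x * y) = star y * star x"
    and norm_star_mult_self: "norm (star x * x) = (norm x)\<^sup>2"

text \<open>
  The unit comes from \<^class>\<open>monoid_mult\<close> rather than \<^class>\<open>real_normed_algebra_1\<close>:
  the latter assumes \<open>0 \<noteq> 1\<close> and would exclude the zero algebra.
\<close>

class unital_cstar_algebra = cstar_algebra + monoid_mult

definition scalar :: "complex \<Rightarrow> 'a::unital_cstar_algebra" where
  "scalar c = c *\<^sub>C 1"

definition cstar_spectrum :: "'a::unital_cstar_algebra \<Rightarrow> complex set" where
  "cstar_spectrum x = {c. \<not> (\<exists>y. (scalar c - x) * y = 1 \<and> y * (scalar c - x) = 1)}"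

definition selfadjoint :: "'a::cstar_algebra \<Rightarrow> bool" where
  "selfadjoint x \<longleftrightarrow> star x = x"

definition cstar_positive :: "'a::unital_cstar_algebra \<Rightarrow> bool" where
  "cstar_positive x \<longleftrightarrow> selfadjoint x \<and> cstar_spectrum x \<subseteq> complex_of_real ` {0..}"

definition cstar_le :: "'a::unital_cstar_algebra \<Rightarrow> 'a \<Rightarrow> bool" (infix "\<preceq>" 50) where
  "x \<preceq> y \<longleftrightarrow> selfadjoint x \<and> selfadjoint y \<and> cstar_positive (y - x)"

definition Re_part :: "'a::cstar_algebra \<Rightarrow> 'a" where
  "Re_part x = (1/2) *\<^sub>C (x + star x)"

text \<open>
  The definite description is meant for positive arguments, which have exactly one positive
  square root.
\<close>

definition cstar_sqrt :: "'a::unital_cstar_algebra \<Rightarrow> 'a" where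
  "cstar_sqrt x = (THE p. cstar_positive p \<and> p * p = x)"

definition cstar_abs :: "'a::unital_cstar_algebra \<Rightarrow> 'a" where
  "cstar_abs x = cstar_sqrt (star x * x)"

definition cstar_subalgebra :: "'a::cstar_algebra set \<Rightarrow> bool" where
  "cstar_subalgebra S \<longleftrightarrow>
     0 \<in> S \<and> (\<forall>x\<in>S. \<forall>y\<in>S. x + y \<in> S) \<and> (\<forall>c. \<forall>x\<in>S. c *\<^sub>C x \<in> S) \<and>
     (\<forall>x\<in>S. \<forall>y\<in>S. x * y \<in> S) \<and> (\<forall>x\<in>S. star x \<in> S) \<and> closed S"

text \<open>
  A map into a C*-subalgebra \<open>S\<close> is a map of the ambient algebra with range in \<open>S\<close>. Its
  positivity refers to the spectrum in the ambient algebra; for a C*-subalgebra containing the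
  unit this is the same as the spectrum in \<open>S\<close> (spectral permanence), and without using that
  fact it is the weaker requirement on the map.
\<close>

definition positive_linear_map :: "('a::unital_cstar_algebra \<Rightarrow> 'b::unital_cstar_algebra) \<Rightarrow> bool" where
  "positive_linear_map \<Phi> \<longleftrightarrow>
     Vector_Spaces.linear (*\<^sub>C) (*\<^sub>C) \<Phi> \<and> (\<forall>x. cstar_positive x \<longrightarrow> cstar_positive (\<Phi> x))"

definition left_multiplier :: "'a::unital_cstar_algebra set \<Rightarrow> ('a \<Rightarrow> 'a) \<Rightarrow> bool" where
  "left_multiplier S \<Phi> \<longleftrightarrow>
     positive_linear_map \<Phi> \<and> range \<Phi> \<subseteq> S \<and> (\<forall>x. \<forall>y\<in>S. \<Phi> (x * y) = \<Phi> x * y)"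

end

theory Submission
  imports Defs
begin

text \<open>
  The \<open>\<B>\<close>-valued form \<open>\<Phi> (star X * Y)\<close> is positive and satisfies the Cauchy-Schwarz inequality
  \<open>norm (\<Phi> (star X * Y))\<^sup>2 \<le> norm (\<Phi> (star X * X)) * norm (\<Phi> (star Y * Y))\<close>. Since \<open>\<Phi>\<close> fixes its
  range, at \<open>X = A - \<Phi> A\<close> and \<open>Y = B - \<Phi> B\<close> it takes the value
  \<open>\<Phi> (star A * B) - star (\<Phi> A) * \<Phi> B\<close>. With \<open>c = (M + m) / 2\<close> the hypothesis on \<open>A\<close> says
  \<open>star (A - c) * (A - c) \<le> \<bar>M - m\<bar>\<^sup>2 / 4\<close>, and the variance \<open>\<Phi> (star X * X)\<close> of \<open>A\<close> is
  unchanged by the shift to \<open>A - c\<close>, hence is at most \<open>\<bar>M - m\<bar>\<^sup>2 / 4\<close>.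

  The C*-algebra theory behind this is elementary: for self-adjoint elements the spectral radius is
  the norm, positive elements have unique positive square roots, and \<open>star x * x\<close> is positive.
\<close>

section \<open>Units and the spectrum\<close>

lemma scaleC_one [simp]: "(1::complex) *\<^sub>C (x::'a::cstar_algebra) = x"
  using scaleR_scaleC[of 1 x] by simp

lemma scaleC_zero_left [simp]: "(0::complex) *\<^sub>C (x::'a::cstar_algebra) = 0"
  using scaleR_scaleC[of 0 x] by simp

lemma scaleC_zero_right [simp]: "c *\<^sub>C (0::'a::cstar_algebra) = 0"
  using scaleC_add_right[of c 0 "0::'a"] by simp

lemma scaleC_minus_left [simp]: "(- c) *\<^sub>C (x::'a::cstar_algebra) = - (c *\<^sub>C x)"
  using scaleC_add_left[of c "-c" x] by (simp add: eq_neg_iff_add_eq_0 add.commute)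

lemma scaleC_minus_right [simp]: "c *\<^sub>C (- x::'a::cstar_algebra) = - (c *\<^sub>C x)"
  using scaleC_add_right[of c x "-x"] by (simp add: eq_neg_iff_add_eq_0 add.commute)

lemma scaleC_diff_left: "(c - d) *\<^sub>C (x::'a::cstar_algebra) = c *\<^sub>C x - d *\<^sub>C x"
  using scaleC_add_left[of c "-d" x] by simp

lemma scaleC_diff_right: "c *\<^sub>C (x - y::'a::cstar_algebra) = c *\<^sub>C x - c *\<^sub>C y"
  using scaleC_add_right[of c x "-y"] by simp

lemma star_zero [simp]: "star (0::'a::cstar_algebra) = 0"
  using star_add[of 0 "0::'a"] by simp

lemma star_minus [simp]: "star (- x::'a::cstar_algebra) = - star x"
  using star_add[of x "-x"] by (simp add: eq_neg_iff_add_eq_0 add.commute)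

lemma star_diff: "star (x - y::'a::cstar_algebra) = star x - star y"
  using star_add[of x "-y"] by simp

lemma star_scaleR: "star (r *\<^sub>R x::'a::cstar_algebra) = r *\<^sub>R star x"
  by (simp add: scaleR_scaleC star_scaleC)

lemma star_one [simp]: "star (1::'a::unital_cstar_algebra) = 1"
  by (metis mult.right_neutral star_mult star_star)

text \<open>Submultiplicativity in the C*-identity gives \<open>norm y \<le> norm (star y)\<close>
  after cancelling \<open>norm y\<close>; since \<open>star\<close> is an involution, the reverse
  inequality is the same one at \<open>star x\<close>.\<close>

lemma norm_star [simp]: "norm (star (x::'a::cstar_algebra)) = norm x"
proof -
  have le: "norm y \<le> norm (star y)" for y :: 'a
  proof (cases "norm y = 0")
    case False
    have "norm y * norm y \<le> norm (star y) * norm y"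
      using norm_star_mult_self[of y] norm_mult_ineq[of "star y" y] by (simp add: power2_eq_square)
    then show ?thesis
      using False by simp
  qed simp
  show ?thesis
    using le[of x] le[of "star x"] by (simp add: star_star)
qed

text \<open>By the C*-identity \<open>norm 1\<close> equals its own square, so it is 0 or 1; the
  value 0 is that of the zero algebra.\<close>

lemma norm_one_le: "norm (1::'a::unital_cstar_algebra) \<le> 1"
proof -
  have "norm (1::'a) = (norm (1::'a))\<^sup>2"
    using norm_star_mult_self[of "1::'a"] by simp
  then show ?thesis
    by (cases "norm (1::'a) = 0") (simp_all only: power2_eq_square mult_cancel_left1, auto)
qed

lemma norm_selfadjoint_square: "selfadjoint (x::'a::cstar_algebra) \<Longrightarrow> norm (x * x) = (norm x)\<^sup>2"
  using norm_star_mult_self[of x] by (simp add: selfadjoint_def)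

lemma selfadjoint_zero [simp]: "selfadjoint (0::'a::cstar_algebra)"
  and selfadjoint_add: "selfadjoint x \<Longrightarrow> selfadjoint y \<Longrightarrow> selfadjoint (x + y :: 'a)"
  and selfadjoint_diff: "selfadjoint x \<Longrightarrow> selfadjoint y \<Longrightarrow> selfadjoint (x - y :: 'a)"
  and selfadjoint_minus: "selfadjoint x \<Longrightarrow> selfadjoint (- x :: 'a)"
  and selfadjoint_scaleR: "selfadjoint x \<Longrightarrow> selfadjoint (r *\<^sub>R x :: 'a)"
  and selfadjoint_mult: "selfadjoint x \<Longrightarrow> selfadjoint y \<Longrightarrow> x * y = y * x \<Longrightarrow> selfadjoint (x * y :: 'a)"
  and selfadjoint_star_mult: "selfadjoint (star z * z :: 'a)"
  by (auto simp: selfadjoint_def star_add star_diff star_scaleR star_mult star_star)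

lemma selfadjoint_one [simp]: "selfadjoint (1::'a::unital_cstar_algebra)"
  by (simp add: selfadjoint_def)

lemma scalar_of_real: "scalar (complex_of_real r) = r *\<^sub>R (1::'a::unital_cstar_algebra)"
  by (simp add: scalar_def scaleR_scaleC)

lemma scalar_add: "scalar (c + d) = (scalar c + scalar d :: 'a::unital_cstar_algebra)"
  and scalar_diff: "scalar (c - d) = (scalar c - scalar d :: 'a)"
  and scalar_minus: "scalar (- c) = (- scalar c :: 'a)"
  and scalar_mult: "scalar (c * d) = (scalar c * scalar d :: 'a)"
  and scalar_mult_left: "scalar c * x = c *\<^sub>C (x :: 'a)"
  and scalar_mult_right: "x * scalar c = c *\<^sub>C (x :: 'a)"
  and star_scalar: "star (scalar c) = (scalar (cnj c) :: 'a)"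
  by (simp_all add: scalar_def scaleC_add_left scaleC_diff_left mult_scaleC_left mult_scaleC_right
      scaleC_scaleC star_scaleC mult.commute)

lemma norm_scalar_le: "norm (scalar c :: 'a::unital_cstar_algebra) \<le> cmod c"
  using mult_left_mono[OF norm_one_le, of "cmod c"] by (simp add: scalar_def norm_scaleC)

section \<open>Invertible elements and the reality of self-adjoint spectra\<close>

definition inverse_pair :: "'a::unital_cstar_algebra \<Rightarrow> 'a \<Rightarrow> bool" where
  "inverse_pair x y \<longleftrightarrow> x * y = 1 \<and> y * x = 1"

definition unit_element :: "'a::unital_cstar_algebra \<Rightarrow> bool" where
  "unit_element x \<longleftrightarrow> (\<exists>y. inverse_pair x y)"

lemma cstar_spectrum_iff: "c \<in> cstar_spectrum x \<longleftrightarrow> \<not> unit_element (scalar c - x)"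
  by (simp add: cstar_spectrum_def unit_element_def inverse_pair_def)

lemma left_right_inverse_unique:
  fixes x :: "'a::monoid_mult"
  assumes "x * r = 1" "l * x = 1"
  shows "l = r"
  using mult.assoc[of l x r] assms by simp

lemma unit_elementI:
  assumes "x * r = 1" "l * x = 1"
  shows "unit_element x"
  using left_right_inverse_unique[OF assms] assms by (auto simp: unit_element_def inverse_pair_def)

lemma unit_element_mult:
  assumes "unit_element x" "unit_element y"
  shows "unit_element (x * y)"
proof -
  obtain x' y' where *: "x * x' = 1" "x' * x = 1" "y * y' = 1" "y' * y = 1"
    using assms by (auto simp: unit_element_def inverse_pair_def)
  have "x * y * (y' * x') = x * (y * y') * x'" "y' * x' * (x * y) = y' * (x' * x) * y"
    by (simp_all only: mult.assoc)
  then show ?thesis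
    by (intro unit_elementI[of _ "y' * x'" "y' * x'"]) (simp_all add: *)
qed

lemma unit_element_factor:
  assumes "x * y = y * x" "unit_element (x * y)"
  shows "unit_element x"
proof -
  obtain w where "x * y * w = 1" "w * (x * y) = 1"
    using assms(2) by (auto simp: unit_element_def inverse_pair_def)
  then show ?thesis
    by (intro unit_elementI[of _ "y * w" "w * y"]) (simp_all add: mult.assoc[symmetric] assms(1))
qed

lemma unit_element_scaleC:
  assumes "c \<noteq> 0" "unit_element x"
  shows "unit_element (c *\<^sub>C x)"
proof -
  obtain y where "x * y = 1" "y * x = 1"
    using assms(2) by (auto simp: unit_element_def inverse_pair_def)
  then show ?thesis
    using assms(1)
    by (intro unit_elementI[of _ "inverse c *\<^sub>C y" "inverse c *\<^sub>C y"])
      (simp_all add: mult_scaleC_left mult_scaleC_right scaleC_scaleC)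
qed

lemma unit_element_minus: "unit_element (- x) \<longleftrightarrow> unit_element x"
  using unit_element_scaleC[of "-1" x] unit_element_scaleC[of "-1" "-x"] by auto

text \<open>The right and left inverses are the fixed points of \<open>\<lambda>y. 1 + x * y\<close>
  and \<open>\<lambda>y. 1 + y * x\<close>, which are contractions with constant
  \<open>norm x\<close>; this takes the place of the Neumann series.\<close>

lemma unit_element_one_minus:
  fixes x :: "'a::unital_cstar_algebra"
  assumes "norm x < 1"
  shows "unit_element (1 - x)"
proof -
  have "\<exists>!y. 1 + x * y = y"
    using assms
    by (intro banach_fix_type[of "norm x"])
      (auto simp: dist_norm right_diff_distrib[symmetric] intro: norm_mult_ineq)
  moreover have "\<exists>!y. 1 + y * x = y"
    using assms
    by (intro banach_fix_type[of "norm x"])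
      (auto simp: dist_norm left_diff_distrib[symmetric] mult.commute[of "norm x"] intro: norm_mult_ineq)
  ultimately obtain r l where "1 + x * r = r" "1 + l * x = l"
    by blast
  then show ?thesis
    by (intro unit_elementI[of _ r l]) (simp_all add: algebra_simps eq_diff_eq)
qed

lemma unit_element_scalar_minus:
  fixes x :: "'a::unital_cstar_algebra"
  assumes "norm x < cmod c"
  shows "unit_element (scalar c - x)"
proof -
  have c: "c \<noteq> 0" using assms by auto
  have "norm (inverse c *\<^sub>C x) < 1"
    using assms c by (simp add: norm_scaleC norm_inverse pos_divide_less_eq flip: divide_inverse_commute)
  then have "unit_element (c *\<^sub>C (1 - inverse c *\<^sub>C x))"
    by (intro unit_element_scaleC c unit_element_one_minus)
  then show ?thesis
    using c by (simp add: scaleC_diff_right scaleC_scaleC scalar_def)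
qed

lemma spectrum_norm_le:
  fixes x :: "'a::unital_cstar_algebra"
  shows "c \<in> cstar_spectrum x \<Longrightarrow> cmod c \<le> norm x"
  using unit_element_scalar_minus[of x c] by (force simp: cstar_spectrum_iff)

lemma spectrum_scalar_minus: "c \<in> cstar_spectrum x \<longleftrightarrow> t - c \<in> cstar_spectrum (scalar t - x)"
proof -
  have "scalar (t - c) - (scalar t - x) = - (scalar c - x)"
    by (simp add: scalar_diff)
  then show ?thesis
    by (simp only: cstar_spectrum_iff unit_element_minus)
qed

lemma spectrum_add_scalar: "c \<in> cstar_spectrum x \<longleftrightarrow> c + t \<in> cstar_spectrum (x + scalar t)"
  by (simp add: cstar_spectrum_iff scalar_add)

text \<open>Shifting \<open>x\<close> by an imaginary scalar \<open>\<i> * t\<close> adds at most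
  \<open>t\<^sup>2\<close> to the bound on the squared norm, whereas the squared modulus of the
  shifted spectral point also gains the linear term \<open>2 * Im c * t\<close>.\<close>

lemma spectrum_selfadjoint_real:
  fixes x :: "'a::unital_cstar_algebra"
  assumes "selfadjoint x" "c \<in> cstar_spectrum x"
  shows "c \<in> \<real>"
proof (rule ccontr)
  assume "c \<notin> \<real>"
  then have im: "Im c \<noteq> 0"
    by (simp add: complex_is_Real_iff)
  \<comment> \<open>Chosen so that the linear term \<open>2 * Im c * t\<close> is
    \<open>(norm x)\<^sup>2 + 1\<close>, just beyond what the norm bound permits.\<close>
  define t where "t = ((norm x)\<^sup>2 + 1) / (2 * Im c)"
  define u where "u = \<i> * complex_of_real t"
  have "(cmod (c + u))\<^sup>2 \<le> (norm (x + scalar u))\<^sup>2"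
    using assms(2) spectrum_norm_le[of "c + u" "x + scalar u"] spectrum_add_scalar[of c x u]
    by (simp add: power_mono)
  also have "\<dots> = norm (x * x + scalar (complex_of_real (t\<^sup>2)))"
  proof -
    have "star (x + scalar u) * (x + scalar u) = (x - scalar u) * (x + scalar u)"
      using assms(1)
      by (simp add: selfadjoint_def star_add star_scalar u_def scalar_minus)
    also have "\<dots> = x * x - scalar (u * u)"
      by (simp add: algebra_simps scalar_mult scalar_mult_left scalar_mult_right scaleC_add_right scaleC_diff_right)
    also have "\<dots> = x * x + scalar (complex_of_real (t\<^sup>2))"
    proof -
      have "u * u = - complex_of_real (t\<^sup>2)"
        by (simp add: u_def power2_eq_square complex_eq_iff)
      then show ?thesis
        by (simp add: scalar_minus)
    qed
    finally show ?thesis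
      by (metis norm_star_mult_self)
  qed
  also have "\<dots> \<le> (norm x)\<^sup>2 + t\<^sup>2"
    using norm_triangle_ineq[of "x * x" "scalar (complex_of_real (t\<^sup>2))"]
      norm_scalar_le[of "complex_of_real (t\<^sup>2)", where 'a='a] norm_mult_ineq[of x x]
    by (simp add: power2_eq_square norm_mult)
  finally have "(Re c)\<^sup>2 + (Im c)\<^sup>2 + 2 * (Im c * t) \<le> (norm x)\<^sup>2"
    unfolding cmod_power2 by (simp add: u_def power2_eq_square algebra_simps)
  moreover have "2 * (Im c * t) = (norm x)\<^sup>2 + 1"
    using im by (simp add: t_def)
  ultimately show False
    using zero_le_power2[of "Re c"] zero_le_power2[of "Im c"] by linarith
qed

section \<open>The norm as spectral radius\<close>

text \<open>This is the partial fraction expansion of 1/(1 - y^2) into half the sum of 1/(1 - y) and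
  1/(1 + y).\<close>

lemma inverse_pair_square:
  fixes y :: "'a::unital_cstar_algebra"
  assumes "inverse_pair (1 - y) a" "inverse_pair (1 + y) b"
  shows "inverse_pair (1 - y * y) ((1/2) *\<^sub>R (a + b))"
proof -
  have *: "(1 - y) * a = 1" "a * (1 - y) = 1" "(1 + y) * b = 1" "b * (1 + y) = 1"
    using assms by (simp_all add: inverse_pair_def)
  have f: "1 - y * y = (1 + y) * (1 - y)" "1 - y * y = (1 - y) * (1 + y)"
    by (simp_all add: algebra_simps)
  have "(1 - y * y) * (a + b) = (1 + y) * ((1 - y) * a) + (1 - y) * ((1 + y) * b)"
    unfolding distrib_left by (simp only: f(1) mult.assoc) (simp only: f(1)[symmetric] f(2) mult.assoc[symmetric])
  moreover have "(a + b) * (1 - y * y) = (a * (1 - y)) * (1 + y) + (b * (1 + y)) * (1 - y)"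
    unfolding distrib_right by (simp only: f(2) mult.assoc) (simp only: f(2)[symmetric] f(1) mult.assoc[symmetric])
  ultimately have "(1 - y * y) * (a + b) = 2 *\<^sub>R 1" "(a + b) * (1 - y * y) = 2 *\<^sub>R 1"
    by (simp_all add: * scaleR_2)
  then show ?thesis
    by (simp add: inverse_pair_def)
qed

text \<open>The resolvent identity \<open>b - a = b * (p - q) * a\<close>, with the smallness
  hypothesis serving to bound \<open>norm b\<close> by \<open>2 * norm a\<close>. It yields
  continuity of inversion with an explicit constant.\<close>

lemma inverse_pair_diff_bound:
  fixes p q :: "'a::unital_cstar_algebra"
  assumes "inverse_pair p a" "inverse_pair q b" "norm (p - q) * norm a \<le> 1/2"
  shows "norm (a - b) \<le> 2 * (norm a)\<^sup>2 * norm (p - q)"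
proof -
  have *: "p * a = 1" "b * q = 1"
    using assms by (simp_all add: inverse_pair_def)
  have "b * (p - q) * a = b * (p * a) - (b * q) * a"
    by (simp add: algebra_simps)
  then have "b - a = b * (p - q) * a"
    by (simp add: *)
  then have le: "norm (a - b) \<le> norm b * (norm (p - q) * norm a)"
    by (metis (no_types, opaque_lifting) norm_minus_commute mult.assoc norm_mult_ineq order_trans
        mult_right_mono norm_ge_zero)
  also have "\<dots> \<le> norm b * (1/2)"
    using assms(3) by (intro mult_left_mono) auto
  finally have "norm b \<le> 2 * norm a"
    using norm_triangle_ineq2[of b a] by (simp add: norm_minus_commute)
  then have "norm b * (norm (p - q) * norm a) \<le> 2 * norm a * (norm (p - q) * norm a)"
    by (intro mult_right_mono) auto
  then show ?thesis
    using le by (simp add: power2_eq_square algebra_simps)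
qed

text \<open>For \<open>z \<noteq> 0\<close> the inverse of \<open>1 - z *\<^sub>C x\<close> is a
  rescaled resolvent at \<open>1/z\<close>, and at \<open>z = 0\<close> it is \<open>1\<close>. The
  circles of radius 1 and \<open>t\<close> are compared along each ray; existence of the inverses is
  included so that it too passes to squares.\<close>

definition resolvent_close :: "'a::unital_cstar_algebra \<Rightarrow> real \<Rightarrow> real \<Rightarrow> bool" where
  "resolvent_close x t e \<longleftrightarrow> (\<forall>u. cmod u = 1 \<longrightarrow> (\<exists>a b. inverse_pair (1 - u *\<^sub>C x) a \<and>
     inverse_pair (1 - (complex_of_real t * u) *\<^sub>C x) b \<and> norm (a - b) \<le> e))"

text \<open>
  The resolvent of \<open>x * x\<close> at \<open>w\<^sup>2\<close> is the mean of those of \<open>x\<close> at \<open>w\<close> and \<open>- w\<close>, so the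
  error does not grow under repeated squaring.
\<close>

lemma resolvent_close_square:
  fixes x :: "'a::unital_cstar_algebra"
  assumes "resolvent_close x t e"
  shows "resolvent_close (x * x) (t\<^sup>2) e"
  unfolding resolvent_close_def
proof (intro allI impI)
  fix u :: complex
  assume u: "cmod u = 1"
  define w where "w = csqrt u"
  have w: "w * w = u" "cmod w = 1" "cmod (- w) = 1"
    using u by (simp_all add: w_def flip: power2_eq_square)
  define t' where "t' = complex_of_real t"
  obtain a b where ab: "inverse_pair (1 - w *\<^sub>C x) a" "inverse_pair (1 - (t' * w) *\<^sub>C x) b"
    "norm (a - b) \<le> e"
    using assms w unfolding resolvent_close_def t'_def by blast
  obtain a' b' where ab': "inverse_pair (1 - (- w) *\<^sub>C x) a'"
    "inverse_pair (1 - (t' * - w) *\<^sub>C x) b'" "norm (a' - b') \<le> e"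
    using assms w unfolding resolvent_close_def t'_def by blast
  have "inverse_pair (1 - (w *\<^sub>C x) * (w *\<^sub>C x)) ((1/2) *\<^sub>R (a + a'))"
    using ab ab' by (intro inverse_pair_square) simp_all
  then have 1: "inverse_pair (1 - u *\<^sub>C (x * x)) ((1/2) *\<^sub>R (a + a'))"
    by (simp add: mult_scaleC_left mult_scaleC_right scaleC_scaleC w)
  have "inverse_pair (1 - ((t' * w) *\<^sub>C x) * ((t' * w) *\<^sub>C x)) ((1/2) *\<^sub>R (b + b'))"
    using ab ab' by (intro inverse_pair_square) simp_all
  moreover have "t' * w * (t' * w) = complex_of_real (t\<^sup>2) * u"
    by (simp add: t'_def power2_eq_square flip: w(1))
  ultimately have 2: "inverse_pair (1 - (complex_of_real (t\<^sup>2) * u) *\<^sub>C (x * x)) ((1/2) *\<^sub>R (b + b'))"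
    by (simp only: mult_scaleC_left mult_scaleC_right scaleC_scaleC)
  have "(1/2) *\<^sub>R (a + a') - (1/2) *\<^sub>R (b + b') = (1/2) *\<^sub>R ((a - b) + (a' - b'))"
    by (simp add: algebra_simps)
  then have "norm ((1/2) *\<^sub>R (a + a') - (1/2) *\<^sub>R (b + b')) \<le> e"
    using norm_triangle_ineq[of "a - b" "a' - b'"] ab(3) ab'(3) by simp
  with 1 2 show "\<exists>a b. inverse_pair (1 - u *\<^sub>C (x * x)) a \<and>
     inverse_pair (1 - (complex_of_real (t\<^sup>2) * u) *\<^sub>C (x * x)) b \<and> norm (a - b) \<le> e"
    by blast
qed

text \<open>The C*-identity enters here: squares of self-adjoint elements of norm 1 again have norm
  1. Meanwhile \<open>e\<close> is fixed and the inner radius is squared each time.\<close>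

lemma resolvent_close_iterate:
  fixes x :: "'a::unital_cstar_algebra"
  assumes "selfadjoint x" "norm x = 1" "resolvent_close x t e"
  shows "\<exists>y::'a. selfadjoint y \<and> norm y = 1 \<and> resolvent_close y (t ^ (2 ^ k)) e"
proof (induction k)
  case 0
  then show ?case using assms by auto
next
  case (Suc k)
  then obtain y :: 'a where y: "selfadjoint y" "norm y = 1" "resolvent_close y (t ^ (2 ^ k)) e"
    by blast
  then have "resolvent_close (y * y) (t ^ (2 ^ Suc k)) e"
    using resolvent_close_square[OF y(3)] by (simp add: mult.commute[of 2] flip: power_mult)
  then show ?case
    using y by (intro exI[of _ "y * y"]) (simp add: norm_selfadjoint_square selfadjoint_mult)
qed

text \<open>Inversion along the closed disc is continuous, hence uniformly continuous by
  compactness, so a radius close enough to 1 gives error \<open>e\<close>.\<close>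

lemma resolvent_close_exists:
  fixes x :: "'a::unital_cstar_algebra"
  assumes units: "\<And>z. cmod z \<le> 1 \<Longrightarrow> unit_element (1 - z *\<^sub>C x)" and "e > 0"
  shows "\<exists>t. 0 < t \<and> t < 1 \<and> resolvent_close x t e"
proof -
  define R where "R z = (SOME y. inverse_pair (1 - z *\<^sub>C x) y)" for z
  have R: "inverse_pair (1 - z *\<^sub>C x) (R z)" if "z \<in> cball 0 1" for z
    using units[of z] that unfolding unit_element_def R_def by (auto intro: someI_ex)
  have "continuous_on (cball 0 1) R"
    unfolding continuous_on_iff
  proof (intro ballI allI impI)
    fix z :: complex and e :: real
    assume z: "z \<in> cball 0 1" and e: "0 < e"
    \<comment> \<open>\<open>N\<close> controls the smallness hypothesis of
      \<open>inverse_pair_diff_bound\<close> and \<open>K\<close> is the local Lipschitz constant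
      from its conclusion; the added 1 makes both positive.\<close>
    define N where "N = norm x * norm (R z) + 1"
    define K where "K = 2 * (norm (R z))\<^sup>2 * norm x + 1"
    have N: "N > 0" and K: "K > 0"
      by (auto simp: N_def K_def intro!: add_nonneg_pos)
    show "\<exists>d>0. \<forall>w\<in>cball 0 1. dist w z < d \<longrightarrow> dist (R w) (R z) < e"
    proof (intro exI[of _ "min (1 / (2 * N)) (e / K)"] conjI ballI impI)
      show "0 < min (1 / (2 * N)) (e / K)"
        using N K e by simp
      fix w :: complex
      assume w: "w \<in> cball 0 1" and d: "dist w z < min (1 / (2 * N)) (e / K)"
      have dist: "norm ((1 - z *\<^sub>C x) - (1 - w *\<^sub>C x)) = cmod (w - z) * norm x"
        by (simp add: norm_scaleC flip: scaleC_diff_left)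
      have d1: "cmod (w - z) * N \<le> 1/2" and d2: "cmod (w - z) * K < e"
        using d N K by (auto simp: dist_norm field_simps)
      have "cmod (w - z) * (norm x * norm (R z)) \<le> cmod (w - z) * N"
        by (intro mult_left_mono) (simp_all add: N_def)
      then have "norm ((1 - z *\<^sub>C x) - (1 - w *\<^sub>C x)) * norm (R z) \<le> 1/2"
        using d1 by (simp only: dist mult.assoc)
      then have "norm (R z - R w) \<le> 2 * (norm (R z))\<^sup>2 * (cmod (w - z) * norm x)"
        using inverse_pair_diff_bound[OF R[OF z] R[OF w]] by (simp only: dist)
      also have "\<dots> \<le> cmod (w - z) * K"
        by (simp add: K_def algebra_simps)
      finally show "dist (R w) (R z) < e"
        using d2 by (simp add: dist_norm norm_minus_commute)
    qed
  qed
  then have "uniformly_continuous_on (cball 0 1) R"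
    by (intro compact_uniformly_continuous compact_cball)
  then obtain d where d: "d > 0"
    "\<And>z w. z \<in> cball 0 1 \<Longrightarrow> w \<in> cball 0 1 \<Longrightarrow> dist w z < d \<Longrightarrow> dist (R w) (R z) < e"
    using \<open>e > 0\<close> unfolding uniformly_continuous_on_def by blast
  \<comment> \<open>The maximum with \<open>1/2\<close> keeps \<open>t\<close> positive when
    \<open>d\<close> is large.\<close>
  define t where "t = max (1/2) (1 - d/2)"
  have t: "0 < t" "t < 1" "1 - t < d"
    using d(1) by (auto simp: t_def)
  have "resolvent_close x t e"
    unfolding resolvent_close_def
  proof (intro allI impI)
    fix u :: complex
    assume u: "cmod u = 1"
    define v where "v = complex_of_real t * u"
    have "u - v = complex_of_real (1 - t) * u"
      by (simp add: v_def algebra_simps)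
    then have "dist u v < d"
      using u t unfolding dist_norm by (simp only: norm_mult norm_of_real) simp
    moreover have "u \<in> cball 0 1" "v \<in> cball 0 1"
      using u t by (simp_all add: v_def norm_mult)
    ultimately show "\<exists>a b. inverse_pair (1 - u *\<^sub>C x) a \<and>
        inverse_pair (1 - (complex_of_real t * u) *\<^sub>C x) b \<and> norm (a - b) \<le> e"
      using R[of u] R[of v] d(2)[of v u] unfolding v_def[symmetric] dist_norm by (blast intro: less_imp_le)
  qed
  with t show ?thesis by blast
qed

lemma spectrum_scaleR_iff:
  assumes "r \<noteq> 0"
  shows "complex_of_real r * c \<in> cstar_spectrum (r *\<^sub>R x) \<longleftrightarrow> c \<in> cstar_spectrum x"
proof -
  have "scalar (complex_of_real r * c) - r *\<^sub>R x = complex_of_real r *\<^sub>C (scalar c - x)"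
    by (simp add: scaleR_scaleC scaleC_diff_right scalar_def scaleC_scaleC)
  then show ?thesis
    using unit_element_scaleC[of "complex_of_real r" "scalar c - x"] assms
      unit_element_scaleC[of "complex_of_real (inverse r)" "complex_of_real r *\<^sub>C (scalar c - x)"]
    by (auto simp: cstar_spectrum_iff scaleC_scaleC simp flip: of_real_mult)
qed

text \<open>
  If the spectrum misses the circle of radius \<open>norm x = 1\<close>, the resolvent is uniformly continuous
  on the closed disc. Squaring repeatedly drives the inner resolvent to \<open>1\<close>, hence the outer one
  close to \<open>1\<close>, although the powers of \<open>x\<close> keep norm \<open>1\<close>.
\<close>

lemma spectrum_attains_norm_unit:
  fixes x :: "'a::unital_cstar_algebra"
  assumes x: "selfadjoint x" "norm x = 1"
  shows "\<exists>c\<in>cstar_spectrum x. cmod c = 1"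
proof (rule ccontr)
  assume *: "\<not> ?thesis"
  have "unit_element (1 - z *\<^sub>C x)" if "cmod z \<le> 1" for z
  proof (cases "cmod z < 1")
    case True
    then show ?thesis
      using x by (intro unit_element_one_minus) (simp add: norm_scaleC)
  next
    case False
    with that have z: "cmod z = 1" "z \<noteq> 0" by auto
    then have "cmod (inverse z) = 1"
      by (simp only: norm_inverse inverse_1)
    then have "unit_element (scalar (inverse z) - x)"
      using * cstar_spectrum_iff by blast
    then have "unit_element (z *\<^sub>C (scalar (inverse z) - x))"
      using z by (intro unit_element_scaleC)
    then show ?thesis
      using z by (simp add: scaleC_diff_right scalar_def scaleC_scaleC)
  qed
  \<comment> \<open>With inner radius at most \<open>1/10\<close>, the inner inverse
    \<open>b\<close> satisfies \<open>norm (b - 1) \<le> 1/9\<close>. The error \<open>1/9\<close>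
    then leaves \<open>norm (a - 1) \<le> 2/9\<close>, which forces
    \<open>norm y \<le> 4/9\<close>.\<close>
  then obtain t where t: "0 < t" "t < 1" "resolvent_close x t (1/9)"
    using resolvent_close_exists[of x "1/9"] by auto
  obtain k where k: "t ^ k < 1/10"
    using real_arch_pow_inv[of "1/10" t] t by auto
  have "t ^ (2 ^ k) \<le> t ^ k"
    using t by (intro power_decreasing) (auto intro: less_imp_le)
  with k t obtain s where s: "0 \<le> s" "s \<le> 1/10" "s = t ^ (2 ^ k)"
    by auto
  obtain y :: 'a where y: "norm y = 1" "resolvent_close y s (1/9)"
    using resolvent_close_iterate[OF x t(3)] unfolding s(3) by blast
  obtain a b where "inverse_pair (1 - y) a" "inverse_pair (1 - s *\<^sub>R y) b" and ab: "norm (a - b) \<le> 1/9"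
    using y(2)[unfolded resolvent_close_def, rule_format, of 1] by (auto simp: scaleR_scaleC)
  then have a: "(1 - y) * a = 1" and b: "(1 - s *\<^sub>R y) * b = 1"
    by (auto simp: inverse_pair_def)
  have "b - 1 = s *\<^sub>R (y * b)"
    using b by (simp add: algebra_simps)
  then have "norm (b - 1) = s * norm (y * b)"
    using s(1) by simp
  also have "\<dots> \<le> 1/10 * norm b"
    using s norm_mult_ineq[of y b] y(1) by (intro mult_mono) auto
  finally have b1: "norm (b - 1) \<le> 1/10 * norm b" .
  moreover have "norm b \<le> 1 + norm (b - 1)"
    using norm_triangle_ineq[of 1 "b - 1"] norm_one_le[where 'a='a] by simp
  ultimately have "norm (b - 1) \<le> 1/9"
    by linarith
  then have a1: "norm (a - 1) \<le> 2/9"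
    using norm_triangle_ineq[of "a - b" "b - 1"] ab by simp
  \<comment> \<open>From \<open>(1 - y) * a = 1\<close> one has \<open>a - 1 = y * a\<close>;
    subtracting \<open>y * (a - 1)\<close> leaves \<open>y\<close>.\<close>
  have "y = (a - 1) - y * (a - 1)"
    using a by (simp add: algebra_simps)
  then have "norm y \<le> norm (a - 1) + norm (y * (a - 1))"
    by (metis norm_triangle_ineq4)
  then show False
    using norm_mult_ineq[of y "a - 1"] a1 y(1) by simp
qed

lemma spectrum_attains_norm:
  fixes x :: "'a::unital_cstar_algebra"
  assumes "selfadjoint x" "x \<noteq> 0"
  obtains r :: real where "complex_of_real r \<in> cstar_spectrum x" "\<bar>r\<bar> = norm x"
proof -
  define n where "n = norm x"
  have n: "n > 0" using assms by (simp add: n_def)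
  obtain c where c: "c \<in> cstar_spectrum (inverse n *\<^sub>R x)" "cmod c = 1"
    using spectrum_attains_norm_unit[of "inverse n *\<^sub>R x"] assms n
    by (auto simp: selfadjoint_scaleR n_def)
  then have nc: "complex_of_real n * c \<in> cstar_spectrum x"
    using spectrum_scaleR_iff[of n c "inverse n *\<^sub>R x"] n by simp
  then obtain r where r: "complex_of_real n * c = complex_of_real r"
    using spectrum_selfadjoint_real[OF assms(1)] by (auto elim: Reals_cases)
  then have "\<bar>r\<bar> = cmod (complex_of_real n * c)"
    by simp
  then have "\<bar>r\<bar> = norm x"
    using c n by (simp add: norm_mult n_def)
  with nc r that show ?thesis by metis
qed

section \<open>The positive cone and its description by norms\<close>

lemma cstar_positiveD:
  assumes "cstar_positive x"
  shows "selfadjoint x" "c \<in> cstar_spectrum x \<Longrightarrow> \<exists>r\<ge>0. c = complex_of_real r"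
  using assms by (auto simp: cstar_positive_def)

text \<open>The norm of \<open>t *\<^sub>R 1 - a\<close> is attained at a spectral point
  \<open>t - s\<close> with \<open>s\<close> in the spectrum of \<open>a\<close>, and
  \<open>0 \<le> s \<le> t\<close>. Together with \<open>cstar_positiveI_norm\<close> this turns
  positivity into a norm condition.\<close>

lemma cstar_positive_norm_le:
  fixes a :: "'a::unital_cstar_algebra"
  assumes "cstar_positive a" "norm a \<le> t"
  shows "norm (t *\<^sub>R 1 - a) \<le> t"
proof (cases "t *\<^sub>R 1 - a = 0")
  case True
  then show ?thesis using assms(2) norm_ge_zero[of a] by (simp del: norm_ge_zero)
next
  case False
  obtain r where r: "complex_of_real r \<in> cstar_spectrum (t *\<^sub>R 1 - a)" "\<bar>r\<bar> = norm (t *\<^sub>R 1 - a)"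
    using spectrum_attains_norm[OF _ False] assms(1)
    by (auto simp: selfadjoint_diff selfadjoint_scaleR cstar_positive_def)
  have *: "complex_of_real (t - r) \<in> cstar_spectrum a"
    using spectrum_scalar_minus[of "complex_of_real r" "t *\<^sub>R 1 - a" "complex_of_real t"] r(1)
    by (simp add: scalar_of_real)
  then obtain s where s: "s \<ge> 0" "complex_of_real (t - r) = complex_of_real s"
    using cstar_positiveD(2)[OF assms(1)] by blast
  then have "t - r = s"
    by (simp only: of_real_eq_iff)
  moreover have "\<bar>t - r\<bar> \<le> t"
    using spectrum_norm_le[OF *] assms(2) by (simp only: norm_of_real)
  ultimately show ?thesis
    using r(2) s(1) by linarith
qed

text \<open>The spectrum is real and lies within distance \<open>t\<close> of \<open>t\<close>, so
  it cannot reach below 0.\<close>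

lemma cstar_positiveI_norm:
  fixes a :: "'a::unital_cstar_algebra"
  assumes "selfadjoint a" "norm (t *\<^sub>R 1 - a) \<le> t"
  shows "cstar_positive a"
  unfolding cstar_positive_def
proof (intro conjI assms(1) subsetI)
  fix c assume c: "c \<in> cstar_spectrum a"
  then obtain r where r: "c = complex_of_real r"
    using spectrum_selfadjoint_real[OF assms(1)] by (auto elim: Reals_cases)
  have "complex_of_real (t - r) \<in> cstar_spectrum (t *\<^sub>R 1 - a)"
    using spectrum_scalar_minus[of c a "complex_of_real t"] c by (simp add: r scalar_of_real)
  then have "\<bar>t - r\<bar> \<le> t"
    using spectrum_norm_le[of "complex_of_real (t - r)" "t *\<^sub>R 1 - a"] assms(2)
    unfolding norm_of_real by linarith
  then show "c \<in> complex_of_real ` {0..}"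
    by (auto simp: r)
qed

text \<open>The spectra of \<open>a\<close> and \<open>b\<close> say little directly about that of
  \<open>a + b\<close>; in the norm description closure under sums is the triangle
  inequality.\<close>

lemma cstar_positive_add:
  fixes a b :: "'a::unital_cstar_algebra"
  assumes "cstar_positive a" "cstar_positive b"
  shows "cstar_positive (a + b)"
proof (rule cstar_positiveI_norm[where t = "norm a + norm b"])
  show "selfadjoint (a + b)"
    using assms by (auto simp: cstar_positive_def selfadjoint_add)
  have "(norm a + norm b) *\<^sub>R 1 - (a + b) = (norm a *\<^sub>R 1 - a) + (norm b *\<^sub>R 1 - b)"
    by (simp add: algebra_simps)
  then show "norm ((norm a + norm b) *\<^sub>R 1 - (a + b)) \<le> norm a + norm b"
    using norm_triangle_mono cstar_positive_norm_le[OF assms(1) order_refl]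
      cstar_positive_norm_le[OF assms(2) order_refl] by metis
qed

lemma cstar_positive_scaleR:
  fixes a :: "'a::unital_cstar_algebra"
  assumes "cstar_positive a" "r \<ge> 0"
  shows "cstar_positive (r *\<^sub>R a)"
proof (rule cstar_positiveI_norm[where t = "r * norm a"])
  show "selfadjoint (r *\<^sub>R a)"
    using assms by (auto simp: cstar_positive_def selfadjoint_scaleR)
  have "(r * norm a) *\<^sub>R 1 - r *\<^sub>R a = r *\<^sub>R (norm a *\<^sub>R 1 - a)"
    by (simp add: algebra_simps)
  then show "norm ((r * norm a) *\<^sub>R 1 - r *\<^sub>R a) \<le> r * norm a"
    using cstar_positive_norm_le[OF assms(1) order_refl] assms(2) by (simp add: mult_left_mono)
qed

lemma cstar_positive_scaleR_one: "r \<ge> 0 \<Longrightarrow> cstar_positive (r *\<^sub>R 1)"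
  by (rule cstar_positiveI_norm[where t = r]) (simp_all add: selfadjoint_scaleR)

lemma norm_scaleR_one_minus_positive:
  fixes a :: "'a::unital_cstar_algebra"
  assumes "selfadjoint a" "norm a \<le> t"
  shows "cstar_positive (t *\<^sub>R 1 - a)"
proof (rule cstar_positiveI_norm[where t = t])
  show "selfadjoint (t *\<^sub>R 1 - a)"
    using assms by (simp add: selfadjoint_diff selfadjoint_scaleR)
qed (use assms in simp)

text \<open>One of \<open>norm a\<close> and \<open>- norm a\<close> is a spectral point of a
  nonzero \<open>a\<close>, and the two positivity hypotheses confine it to the interval from 0 to
  \<open>t\<close>.\<close>

lemma cstar_positive_bounded_norm:
  fixes a :: "'a::unital_cstar_algebra"
  assumes "cstar_positive a" "cstar_positive (t *\<^sub>R 1 - a)" "t \<ge> 0"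
  shows "norm a \<le> t"
proof (cases "a = 0")
  case False
  then obtain r where r: "complex_of_real r \<in> cstar_spectrum a" "\<bar>r\<bar> = norm a"
    using spectrum_attains_norm assms(1) by (auto simp: cstar_positive_def)
  have "complex_of_real (t - r) \<in> cstar_spectrum (t *\<^sub>R 1 - a)"
    using spectrum_scalar_minus[of "complex_of_real r" a "complex_of_real t"] r(1)
    by (simp add: scalar_of_real)
  then obtain s where "s \<ge> 0" "complex_of_real (t - r) = complex_of_real s"
    using cstar_positiveD(2)[OF assms(2)] by blast
  then have "r \<le> t"
    by (metis of_real_eq_iff diff_ge_0_iff_ge)
  moreover have "r \<ge> 0"
    using cstar_positiveD(2)[OF assms(1) r(1)] by (auto simp: of_real_eq_iff)
  ultimately show ?thesis
    using r(2) by linarith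
qed (use assms(3) in simp)

lemma cstar_positive_antisym:
  fixes a :: "'a::unital_cstar_algebra"
  assumes "cstar_positive a" "cstar_positive (- a)"
  shows "a = 0"
  using cstar_positive_bounded_norm[OF assms(1), of 0] assms(2) by simp

section \<open>Square roots and positive elements\<close>

text \<open>With \<open>s\<close> a complex root of \<open>c\<close>, the factorization
  \<open>(scalar s - y) * (scalar s + y)\<close> puts \<open>s\<close> or \<open>- s\<close> into
  the real spectrum of \<open>y\<close>, so \<open>c\<close> is the square of a real number.\<close>

lemma cstar_positive_square:
  fixes y :: "'a::unital_cstar_algebra"
  assumes "selfadjoint y"
  shows "cstar_positive (y * y)"
  unfolding cstar_positive_def
proof (intro conjI subsetI)
  show "selfadjoint (y * y)"
    using assms by (simp add: selfadjoint_mult)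
  fix c assume c: "c \<in> cstar_spectrum (y * y)"
  define s where "s = csqrt c"
  have s: "s * s = c"
    by (simp add: s_def flip: power2_eq_square)
  have "scalar c - y * y = (scalar s - y) * (scalar s + y)"
    by (simp add: algebra_simps scalar_mult_left scalar_mult_right scaleC_add_right scaleC_diff_right)
      (simp add: scalar_def scaleC_scaleC s)
  then have "\<not> unit_element (scalar s - y) \<or> \<not> unit_element (- (scalar s + y))"
    using c unit_element_mult unfolding cstar_spectrum_iff unit_element_minus by metis
  then have "s \<in> cstar_spectrum y \<or> - s \<in> cstar_spectrum y"
    by (simp add: cstar_spectrum_iff scalar_minus)
  then have "s \<in> \<real>"
    using spectrum_selfadjoint_real[OF assms] Reals_minus_iff by blast
  then obtain r where "s = complex_of_real r"
    by (auto elim: Reals_cases)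
  then have "c = complex_of_real (r * r)"
    using s by simp
  then show "c \<in> complex_of_real ` {0..}"
    by (intro image_eqI[of _ _ "r * r"]) simp_all
qed

lemma commute_square:
  fixes z s :: "'a::semigroup_mult"
  assumes "z * s = s * z"
  shows "z * (s * s) = s * s * z"
proof -
  have "z * (s * s) = z * s * s"
    by (rule mult.assoc[symmetric])
  also have "\<dots> = s * (z * s)"
    by (simp only: assms mult.assoc)
  finally show ?thesis
    by (simp only: assms mult.assoc)
qed

text \<open>A fixed point \<open>y\<close> of this iteration satisfies \<open>(1 - y) * (1 - y) = 1 - b\<close>.\<close>

primrec sqrt_iter :: "'a::real_normed_algebra \<Rightarrow> nat \<Rightarrow> 'a" where
  "sqrt_iter b 0 = 0"
| "sqrt_iter b (Suc n) = (1/2) *\<^sub>R (b + sqrt_iter b n * sqrt_iter b n)"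

lemma sqrt_iter_commute: "z * b = b * z \<Longrightarrow> z * sqrt_iter b n = sqrt_iter b n * z"
proof (induction n)
  case (Suc n)
  then have "z * (sqrt_iter b n * sqrt_iter b n) = sqrt_iter b n * sqrt_iter b n * z"
    by (simp add: commute_square)
  then show ?case
    using Suc.prems by (simp add: distrib_left distrib_right)
qed simp

lemma sqrt_iter_selfadjoint:
  fixes b :: "'a::cstar_algebra"
  shows "selfadjoint b \<Longrightarrow> selfadjoint (sqrt_iter b n)"
  by (induction n) (simp_all add: selfadjoint_add selfadjoint_mult selfadjoint_scaleR)

text \<open>The real iteration at 1 is the majorant for the iteration at every \<open>b\<close> of
  norm at most 1.\<close>

lemma sqrt_iter_one_bounds: "0 \<le> sqrt_iter (1::real) n \<and> sqrt_iter (1::real) n \<le> 1"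
  by (induction n) (auto simp: mult_le_one)

lemma norm_sqrt_iter_le:
  assumes "norm b \<le> 1"
  shows "norm (sqrt_iter b n) \<le> sqrt_iter (1::real) n"
proof (induction n)
  case (Suc n)
  have "norm (sqrt_iter b n * sqrt_iter b n) \<le> sqrt_iter 1 n * sqrt_iter (1::real) n"
    using Suc by (intro order_trans[OF norm_mult_ineq] mult_mono) (auto simp: sqrt_iter_one_bounds)
  then show ?case
    using norm_triangle_ineq[of b "sqrt_iter b n * sqrt_iter b n"] assms by simp
qed simp

text \<open>The iterates commute, so a difference of consecutive squares factors into difference
  times sum, and both factors are dominated by their real counterparts. This also covers
  \<open>norm b = 1\<close>, with no contraction constant.\<close>

lemma norm_sqrt_iter_diff_le:
  fixes b :: "'a::real_normed_algebra"
  assumes "norm b \<le> 1"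
  shows "norm (sqrt_iter b (Suc n) - sqrt_iter b n) \<le> sqrt_iter (1::real) (Suc n) - sqrt_iter 1 n"
proof (induction n)
  case 0
  then show ?case using assms by simp
next
  case (Suc n)
  let ?y = "sqrt_iter b n" and ?y' = "sqrt_iter b (Suc n)"
  let ?z = "sqrt_iter (1::real) n" and ?z' = "sqrt_iter (1::real) (Suc n)"
  have "?y' * ?y = ?y * ?y'"
    by (intro sqrt_iter_commute sqrt_iter_commute[symmetric] refl)
  then have "?y' * ?y' - ?y * ?y = (?y' - ?y) * (?y' + ?y)"
    by (simp only: algebra_simps)
  then have "norm (?y' * ?y' - ?y * ?y) \<le> norm (?y' - ?y) * norm (?y' + ?y)"
    by (simp only: norm_mult_ineq)
  also have "\<dots> \<le> (?z' - ?z) * (?z' + ?z)"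
  proof (rule mult_mono)
    show "norm (?y' - ?y) \<le> ?z' - ?z"
      by (rule Suc)
    then show "0 \<le> ?z' - ?z"
      by (rule order_trans[OF norm_ge_zero])
    show "norm (?y' + ?y) \<le> ?z' + ?z"
      by (intro norm_triangle_mono norm_sqrt_iter_le[OF assms])
  qed (rule norm_ge_zero)
  finally have *: "norm (?y' * ?y' - ?y * ?y) \<le> (?z' - ?z) * (?z' + ?z)" .
  have "sqrt_iter b (Suc (Suc n)) - ?y' = (1/2) *\<^sub>R (?y' * ?y' - ?y * ?y)"
    unfolding sqrt_iter.simps(2)[of _ "Suc n"] sqrt_iter.simps(2)[of b n]
    by (simp only: algebra_simps)
  then have "norm (sqrt_iter b (Suc (Suc n)) - ?y') = norm (?y' * ?y' - ?y * ?y) / 2"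
    by (simp only: norm_scaleR)
  also have "\<dots> \<le> (?z' - ?z) * (?z' + ?z) / 2"
    using * by simp
  also have "\<dots> = sqrt_iter 1 (Suc (Suc n)) - ?z'"
    unfolding sqrt_iter.simps(2)[of _ "Suc n"] sqrt_iter.simps(2)[of 1 n]
    by (simp add: field_simps)
  finally show ?case .
qed

lemma sqrt_iter_convergent:
  fixes b :: "'a::{real_normed_algebra,banach}"
  assumes "norm b \<le> 1"
  shows "convergent (sqrt_iter b)"
proof -
  let ?z = "sqrt_iter (1::real)"
  \<comment> \<open>The increments of the majorant dominate norms and are therefore nonnegative;
    being bounded as well, the majorant converges and its increments are summable.\<close>
  have mono: "?z n \<le> ?z (Suc n)" for n
    using norm_sqrt_iter_diff_le[OF assms, of n] norm_ge_zero[of "sqrt_iter b (Suc n) - sqrt_iter b n"]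
    by linarith
  then obtain l where "?z \<longlonglongrightarrow> l"
    using incseq_convergent[of ?z 1] sqrt_iter_one_bounds unfolding incseq_Suc_iff by blast
  then have "summable (\<lambda>n. ?z (Suc n) - ?z n)"
    by (rule telescope_summable)
  then have "summable (\<lambda>n. sqrt_iter b (Suc n) - sqrt_iter b n)"
    by (rule summable_comparison_test'[where N = 0]) (rule norm_sqrt_iter_diff_le[OF assms])
  then have "(\<lambda>n. \<Sum>i<n. sqrt_iter b (Suc i) - sqrt_iter b i)
      \<longlonglongrightarrow> (\<Sum>i. sqrt_iter b (Suc i) - sqrt_iter b i)"
    by (rule summable_LIMSEQ)
  then show ?thesis
    by (simp only: sum_lessThan_telescope sqrt_iter.simps(1) diff_zero convergent_def) blast
qed

lemma bounded_linear_star: "bounded_linear (star :: 'a::cstar_algebra \<Rightarrow> 'a)"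
  by (rule bounded_linear_intro[where K = 1]) (simp_all add: star_add star_scaleR)

text \<open>Self-adjointness, the norm bound and commutation hold for each iterate and survive the
  limit; the limit is a fixed point of the iteration.\<close>

lemma sqrt_one_minus_exists:
  fixes b :: "'a::unital_cstar_algebra"
  assumes b: "selfadjoint b" "norm b \<le> 1"
  obtains y where "selfadjoint y" "norm y \<le> 1" "(1 - y) * (1 - y) = 1 - b"
    "\<And>z. z * b = b * z \<Longrightarrow> z * y = y * z"
proof -
  obtain y where y: "sqrt_iter b \<longlonglongrightarrow> y"
    using sqrt_iter_convergent[OF b(2)] by (auto simp: convergent_def)
  have "(\<lambda>n. star (sqrt_iter b n)) \<longlonglongrightarrow> star y"
    by (rule bounded_linear.tendsto[OF bounded_linear_star y])
  then have "sqrt_iter b \<longlonglongrightarrow> star y"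
    using sqrt_iter_selfadjoint[OF b(1)] by (simp add: selfadjoint_def)
  then have 1: "selfadjoint y"
    using y by (auto simp: selfadjoint_def intro: LIMSEQ_unique)
  have "norm (sqrt_iter b n) \<le> 1" for n
    using norm_sqrt_iter_le[OF b(2), of n] sqrt_iter_one_bounds[of n] by linarith
  then have 2: "norm y \<le> 1"
    by (intro LIMSEQ_le_const2[OF tendsto_norm[OF y]]) auto
  have "(\<lambda>n. sqrt_iter b (Suc n)) \<longlonglongrightarrow> (1/2) *\<^sub>R (b + y * y)"
    unfolding sqrt_iter.simps by (intro tendsto_intros y)
  then have "y = (1/2) *\<^sub>R (b + y * y)"
    using LIMSEQ_Suc[OF y] by (rule LIMSEQ_unique[rotated])
  then have "2 *\<^sub>R y = 2 *\<^sub>R ((1/2) *\<^sub>R (b + y * y))"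
    by (rule arg_cong)
  then have "y + y = b + y * y"
    by (simp add: scaleR_2)
  then have 3: "(1 - y) * (1 - y) = 1 - b"
    by (simp add: algebra_simps)
  have 4: "z * y = y * z" if "z * b = b * z" for z
  proof (rule LIMSEQ_unique)
    show "(\<lambda>n. z * sqrt_iter b n) \<longlonglongrightarrow> z * y"
      by (intro tendsto_intros y)
    show "(\<lambda>n. z * sqrt_iter b n) \<longlonglongrightarrow> y * z"
      unfolding sqrt_iter_commute[OF that] by (intro tendsto_intros y)
  qed
  show ?thesis
    using that 1 2 3 4 by blast
qed

text \<open>After division by \<open>norm a\<close> the element is \<open>1 - b\<close> with
  \<open>norm b \<le> 1\<close>, and \<open>1 - y\<close> is its root, positive because
  \<open>norm y \<le> 1\<close>. The commutation clause is what products and uniqueness of roots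
  rely on.\<close>

lemma cstar_positive_sqrt_exists:
  fixes a :: "'a::unital_cstar_algebra"
  assumes a: "cstar_positive a"
  obtains p where "cstar_positive p" "p * p = a" "\<And>z. z * a = a * z \<Longrightarrow> z * p = p * z"
proof (cases "a = 0")
  case True
  then show ?thesis using that[of 0] a by simp
next
  case False
  define n where "n = norm a"
  have n: "n > 0" using False by (simp add: n_def)
  define b where "b = 1 - inverse n *\<^sub>R a"
  have sb: "selfadjoint b"
    using a by (simp add: b_def selfadjoint_diff selfadjoint_scaleR cstar_positive_def)
  have "b = inverse n *\<^sub>R (n *\<^sub>R 1 - a)"
    using n by (simp add: b_def scaleR_diff_right)
  then have "norm b = inverse n * norm (n *\<^sub>R 1 - a)"
    using n by simp
  also have "\<dots> \<le> inverse n * n"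
    using cstar_positive_norm_le[OF a order_refl] n by (intro mult_left_mono) (auto simp: n_def)
  finally have nb: "norm b \<le> 1"
    using n by simp
  obtain y where y: "selfadjoint y" "norm y \<le> 1" "(1 - y) * (1 - y) = 1 - b"
    "\<And>z. z * b = b * z \<Longrightarrow> z * y = y * z"
    using sqrt_one_minus_exists[OF sb nb] by metis
  have "cstar_positive (1 - y)"
    using norm_scaleR_one_minus_positive[OF y(1,2)] by simp
  then have 1: "cstar_positive (sqrt n *\<^sub>R (1 - y))"
    using n by (intro cstar_positive_scaleR) auto
  have 2: "(sqrt n *\<^sub>R (1 - y)) * (sqrt n *\<^sub>R (1 - y)) = a"
    using n by (simp add: y(3)) (simp add: b_def)
  have 3: "z * (sqrt n *\<^sub>R (1 - y)) = (sqrt n *\<^sub>R (1 - y)) * z" if "z * a = a * z" for z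
    using y(4)[of z] that by (simp add: b_def algebra_simps)
  show ?thesis
    using that 1 2 3 by blast
qed

lemma cstar_positive_mult:
  fixes a b :: "'a::unital_cstar_algebra"
  assumes "cstar_positive a" "cstar_positive b" "a * b = b * a"
  shows "cstar_positive (a * b)"
proof -
  obtain p where p: "cstar_positive p" "p * p = a" "\<And>z. z * a = a * z \<Longrightarrow> z * p = p * z"
    using cstar_positive_sqrt_exists[OF assms(1)] by metis
  obtain q where q: "cstar_positive q" "q * q = b" "\<And>z. z * b = b * z \<Longrightarrow> z * q = q * z"
    using cstar_positive_sqrt_exists[OF assms(2)] by metis
  \<comment> \<open>Commutation is transferred twice: \<open>b\<close> commutes with
    \<open>a\<close>, hence with \<open>p\<close>; then \<open>p\<close> commutes with
    \<open>b\<close>, hence with \<open>q\<close>. So \<open>a * b\<close> is the square of the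
    self-adjoint \<open>p * q\<close>.\<close>
  have pq: "p * q = q * p"
    using p(3)[of b] q(3)[of p] assms(3) by simp
  then have "cstar_positive ((p * q) * (p * q))"
    using p(1) q(1) by (intro cstar_positive_square selfadjoint_mult) (auto simp: cstar_positive_def)
  moreover have "(p * q) * (p * q) = p * (q * p) * q"
    by (simp only: mult.assoc)
  ultimately show ?thesis
    by (simp flip: pq p(2) q(2) add: mult.assoc)
qed

text \<open>
  With \<open>u = m + b\<close> and \<open>v = m - b\<close> one has \<open>u * v = 0\<close>, so \<open>(u + l) * (v + l) = l * (2 * m + l)\<close>
  is invertible for every \<open>l > 0\<close>; hence so is \<open>u + l\<close>.
\<close>

lemma cstar_positive_abs_add:
  fixes b m :: "'a::unital_cstar_algebra"
  assumes b: "selfadjoint b" and m: "cstar_positive m" "m * m = b * b" "b * m = m * b"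
  shows "cstar_positive (m + b)"
  unfolding cstar_positive_def
proof (intro conjI subsetI)
  show sa: "selfadjoint (m + b)"
    using b m by (auto simp: cstar_positive_def selfadjoint_add)
  fix c assume c: "c \<in> cstar_spectrum (m + b)"
  then obtain r where r: "c = complex_of_real r"
    using spectrum_selfadjoint_real[OF sa] by (auto elim: Reals_cases)
  have "r \<ge> 0"
  proof (rule ccontr)
    assume "\<not> r \<ge> 0"
    define l where "l = - r"
    have l: "l > 0" using \<open>\<not> r \<ge> 0\<close> by (simp add: l_def)
    define x where "x = (m + b) + l *\<^sub>R 1"
    define y where "y = (m - b) + l *\<^sub>R 1"
    have "x * y = l *\<^sub>R (2 *\<^sub>R m + l *\<^sub>R 1)" "y * x = l *\<^sub>R (2 *\<^sub>R m + l *\<^sub>R 1)"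
      by (simp_all add: x_def y_def algebra_simps m scaleR_2)
    moreover have "unit_element (l *\<^sub>R (2 *\<^sub>R m + l *\<^sub>R 1))"
    proof -
      have "\<not> (\<exists>s\<ge>0. complex_of_real (- l) = complex_of_real s)"
        using l by (simp only: of_real_eq_iff) auto
      then have "complex_of_real (- l) \<notin> cstar_spectrum (2 *\<^sub>R m)"
        using cstar_positiveD(2)[OF cstar_positive_scaleR[OF m(1), of 2]] by fastforce
      then have "unit_element (- (l *\<^sub>R 1) - 2 *\<^sub>R m)"
        by (simp add: cstar_spectrum_iff scalar_of_real flip: of_real_minus)
      then have "unit_element (- (- (l *\<^sub>R 1) - 2 *\<^sub>R m))"
        by (simp only: unit_element_minus)
      then show ?thesis
        using l unfolding scaleR_scaleC by (intro unit_element_scaleC) (simp_all add: add.commute)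
    qed
    ultimately have "unit_element x"
      by (intro unit_element_factor[of x y]) simp_all
    then have "unit_element (- x)"
      by (simp only: unit_element_minus)
    moreover have "- x = scalar c - (m + b)"
      by (simp add: x_def r scalar_of_real l_def)
    ultimately show False
      using c by (simp add: cstar_spectrum_iff)
  qed
  then show "c \<in> complex_of_real ` {0..}"
    by (simp add: r)
qed

text \<open>With \<open>m\<close> the positive root of \<open>b * b\<close>, the parts are half of
  \<open>m + b\<close> and half of \<open>m - b\<close>; they annihilate each other because
  \<open>m\<close> commutes with \<open>b\<close> and has the same square.\<close>

lemma selfadjoint_positive_decomposition:
  fixes b :: "'a::unital_cstar_algebra"
  assumes b: "selfadjoint b"
  obtains p n where "cstar_positive p" "cstar_positive n" "b = p - n" "p * n = 0" "n * p = 0"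
proof -
  obtain m where m: "cstar_positive m" "m * m = b * b" "\<And>z. z * (b * b) = (b * b) * z \<Longrightarrow> z * m = m * z"
    using cstar_positive_sqrt_exists[OF cstar_positive_square[OF b]] by metis
  have bm: "b * m = m * b"
    by (rule m(3)) (simp add: mult.assoc)
  have "cstar_positive (m + b)" "cstar_positive (m + - b)"
    using cstar_positive_abs_add[OF b m(1,2) bm] cstar_positive_abs_add[of "- b" m] b m(1,2) bm
    by (simp_all add: selfadjoint_minus)
  then have "cstar_positive ((1/2) *\<^sub>R (m + b))" "cstar_positive ((1/2) *\<^sub>R (m - b))"
    by (simp_all add: cstar_positive_scaleR)
  moreover have "b = (1/2) *\<^sub>R (m + b) - (1/2) *\<^sub>R (m - b)"
    by (simp add: algebra_simps) (simp flip: scaleR_2)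
  moreover have "((1/2) *\<^sub>R (m + b)) * ((1/2) *\<^sub>R (m - b)) = 0" "((1/2) *\<^sub>R (m - b)) * ((1/2) *\<^sub>R (m + b)) = 0"
    by (simp_all add: algebra_simps m(2) bm)
  ultimately show ?thesis
    using that by blast
qed

section \<open>Positivity of \<open>star x * x\<close>\<close>

lemma spectrum_mult_commute:
  assumes "c \<noteq> 0" "c \<in> cstar_spectrum (x * y)"
  shows "c \<in> cstar_spectrum (y * x)"
  unfolding cstar_spectrum_iff
proof
  assume "unit_element (scalar c - y * x)"
  then obtain w where "(scalar c - y * x) * w = 1" "w * (scalar c - y * x) = 1"
    by (auto simp: unit_element_def inverse_pair_def)
  then have w: "y * x * w = c *\<^sub>C w - 1" "w * (y * x) = c *\<^sub>C w - 1"
    by (simp_all add: left_diff_distrib right_diff_distrib scalar_mult_left scalar_mult_right algebra_simps)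
  \<comment> \<open>The formal geometric series for the inverse of \<open>scalar c - x * y\<close>
    suggests this witness: its terms after the first are those for \<open>y * x\<close>, enclosed
    between \<open>x\<close> and \<open>y\<close>.\<close>
  define z where "z = inverse c *\<^sub>C (1 + x * w * y)"
  have "x * y * (1 + x * w * y) = x * y + x * (y * x * w) * y"
    by (simp add: distrib_left mult.assoc)
  also have "\<dots> = c *\<^sub>C (x * w * y)"
    by (simp only: w) (simp add: algebra_simps mult_scaleC_left mult_scaleC_right)
  finally have 1: "x * y * (1 + x * w * y) = c *\<^sub>C (x * w * y)" .
  have "(1 + x * w * y) * (x * y) = x * y + x * (w * (y * x)) * y"
    by (simp add: distrib_right mult.assoc)
  also have "\<dots> = c *\<^sub>C (x * w * y)"
    by (simp only: w) (simp add: algebra_simps mult_scaleC_left mult_scaleC_right)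
  finally have 2: "(1 + x * w * y) * (x * y) = c *\<^sub>C (x * w * y)" .
  have "(scalar c - x * y) * (1 + x * w * y) = scalar c" "(1 + x * w * y) * (scalar c - x * y) = scalar c"
    by (simp_all add: left_diff_distrib right_diff_distrib 1 2 scalar_mult_left scalar_mult_right scaleC_add_right)
      (simp_all add: scalar_def)
  then have "(scalar c - x * y) * z = 1" "z * (scalar c - x * y) = 1"
    using assms(1) by (simp_all add: z_def mult_scaleC_left mult_scaleC_right scalar_def scaleC_scaleC)
  then have "unit_element (scalar c - x * y)"
    by (rule unit_elementI)
  then show False
    using assms(2) by (simp add: cstar_spectrum_iff)
qed

text \<open>Exchanging the factors can alter the spectrum only at 0, which is a permitted
  value.\<close>

lemma cstar_positive_minus_star_mult_commute:
  fixes y :: "'a::unital_cstar_algebra"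
  assumes "cstar_positive (- (star y * y))"
  shows "cstar_positive (- (y * star y))"
  unfolding cstar_positive_def
proof (intro conjI subsetI)
  show "selfadjoint (- (y * star y))"
    by (simp add: selfadjoint_def star_mult star_star)
  fix c assume c: "c \<in> cstar_spectrum (- (y * star y))"
  show "c \<in> complex_of_real ` {0..}"
  proof (cases "c = 0")
    case True
    then show ?thesis by (intro image_eqI[of _ _ 0]) simp_all
  next
    case False
    have "c \<in> cstar_spectrum ((- y) * star y)"
      using c by simp
    then have "c \<in> cstar_spectrum (star y * (- y))"
      by (rule spectrum_mult_commute[OF False])
    then show ?thesis
      using assms by (auto simp: cstar_positive_def)
  qed
qed

lemma star_mult_self_eq_0_iff: "star y * y = 0 \<longleftrightarrow> y = (0::'a::cstar_algebra)"
  using norm_star_mult_self[of y] by auto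

text \<open>
  \<open>2 * (star y * y + y * star y)\<close> is a sum of two squares of self-adjoint elements, and
  \<open>y * star y\<close> is negative along with \<open>star y * y\<close>, so \<open>star y * y\<close> is both positive and negative.
\<close>

lemma star_mult_self_negative_imp_0:
  fixes y :: "'a::unital_cstar_algebra"
  assumes neg: "cstar_positive (- (star y * y))"
  shows "y = 0"
proof -
  define u where "u = y + star y"
  define v where "v = \<i> *\<^sub>C (y - star y)"
  have "selfadjoint u" "selfadjoint v"
    by (simp_all add: selfadjoint_def u_def v_def star_add star_diff star_star star_scaleC
        scaleC_diff_right add.commute)
  then have sq: "cstar_positive (u * u)" "cstar_positive (v * v)"
    by (simp_all add: cstar_positive_square)
  have vv: "v * v = - ((y - star y) * (y - star y))"
    by (simp add: v_def mult_scaleC_left mult_scaleC_right scaleC_scaleC)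
  have "cstar_positive (u * u + v * v + 2 *\<^sub>R (- (y * star y)))"
    by (intro cstar_positive_add sq cstar_positive_scaleR cstar_positive_minus_star_mult_commute neg) simp
  also have "u * u + v * v + 2 *\<^sub>R (- (y * star y)) = 2 *\<^sub>R (star y * y)"
    unfolding vv u_def by (simp add: algebra_simps scaleR_2)
  finally have "cstar_positive ((1/2) *\<^sub>R (2 *\<^sub>R (star y * y)))"
    by (rule cstar_positive_scaleR) simp
  then have "star y * y = 0"
    using cstar_positive_antisym neg by simp
  then show ?thesis
    by (simp add: star_mult_self_eq_0_iff)
qed

text \<open>Let \<open>n\<close> be the negative part of \<open>star x * x\<close>. Multiplying
  \<open>x\<close> by \<open>n\<close> isolates it: \<open>star (x * n) * (x * n)\<close> is
  \<open>- (n * n * n)\<close>, so \<open>x * n\<close> vanishes by the preceding lemma on negative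
  \<open>star y * y\<close>.\<close>

lemma cstar_positive_star_mult_self: "cstar_positive (star x * (x::'a::unital_cstar_algebra))"
proof -
  obtain p n where pn: "cstar_positive p" "cstar_positive n" "star x * x = p - n" "p * n = 0" "n * p = 0"
    using selfadjoint_positive_decomposition[OF selfadjoint_star_mult] by metis
  have sn: "star n = n"
    using pn(2) by (simp add: cstar_positive_def selfadjoint_def)
  have "star (x * n) * (x * n) = n * (star x * x) * n"
    by (simp add: star_mult sn mult.assoc)
  also have "\<dots> = - (n * n * n)"
    unfolding pn(3) by (simp add: algebra_simps pn(5))
  finally have *: "star (x * n) * (x * n) = - (n * n * n)" .
  have "cstar_positive (n * n * n)"
    using pn(2) by (intro cstar_positive_mult) (simp_all add: mult.assoc)
  then have "x * n = 0"
    using * by (intro star_mult_self_negative_imp_0) simp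
  then have "n * n * n = 0"
    using * by simp
  \<comment> \<open>The fourth power of \<open>n\<close> vanishes, and the C*-identity applied twice
    brings this down to \<open>n\<close> itself.\<close>
  then have "star (n * n) * (n * n) = 0"
    by (simp add: star_mult sn mult.assoc[symmetric])
  then have "star n * n = 0"
    using star_mult_self_eq_0_iff[of "n * n"] by (simp add: sn)
  then have "n = 0"
    by (simp add: star_mult_self_eq_0_iff)
  then show ?thesis
    using pn by simp
qed

section \<open>Uniqueness of positive square roots and the absolute value\<close>

lemma cstar_positive_sum_eq_0:
  fixes a b :: "'a::unital_cstar_algebra"
  assumes "cstar_positive a" "cstar_positive b" "a + b = 0"
  shows "a = 0"
  using cstar_positive_antisym[OF assms(1)] assms(2) minus_unique[OF assms(3)] by simp

text \<open>With \<open>d = p - q\<close> one has \<open>d * (p + q) = 0\<close>. Hence the positive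
  elements \<open>d * d * p\<close> and \<open>d * d * q\<close> sum to 0 and both vanish; their
  difference is the cube of \<open>d\<close>.\<close>

lemma cstar_sqrt_unique:
  fixes p q :: "'a::unital_cstar_algebra"
  assumes p: "cstar_positive p" and q: "cstar_positive q" and eq: "p * p = q * q" and com: "q * p = p * q"
  shows "q = p"
proof -
  define d where "d = p - q"
  have sd: "selfadjoint d"
    using p q by (simp add: d_def selfadjoint_diff cstar_positive_def)
  have dp: "p * (d * d) = d * d * p" and dq: "q * (d * d) = d * d * q"
    by (intro commute_square; simp add: d_def algebra_simps com)+
  have "d * d * p + d * d * q = d * (d * (p + q))"
    by (simp add: algebra_simps)
  also have "d * (p + q) = 0"
    by (simp add: d_def algebra_simps eq com)
  finally have sum: "d * d * p + d * d * q = 0"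
    by simp
  have pos: "cstar_positive (d * d * p)" "cstar_positive (d * d * q)"
    using p q dp dq sd by (auto intro!: cstar_positive_mult cstar_positive_square)
  have "d * d * p = 0" "d * d * q = 0"
    using cstar_positive_sum_eq_0[OF pos sum] cstar_positive_sum_eq_0[OF pos(2,1)] sum
    by (simp_all add: add.commute)
  then have "d * d * d = 0"
    by (simp add: d_def right_diff_distrib)
  then have "star (d * d) * (d * d) = 0"
    using sd by (simp add: star_mult selfadjoint_def mult.assoc[symmetric])
  then have "star d * d = 0"
    using star_mult_self_eq_0_iff[of "d * d"] sd by (simp add: selfadjoint_def)
  then show ?thesis
    by (simp add: star_mult_self_eq_0_iff d_def)
qed

text \<open>Any positive root \<open>q\<close> of \<open>a\<close> commutes with
  \<open>a = q * q\<close>, hence with the constructed root \<open>p\<close>, so uniqueness among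
  commuting roots suffices for the definite description.\<close>

lemma cstar_sqrt:
  fixes a :: "'a::unital_cstar_algebra"
  assumes "cstar_positive a"
  shows "cstar_positive (cstar_sqrt a)" "cstar_sqrt a * cstar_sqrt a = a"
proof -
  obtain p where p: "cstar_positive p" "p * p = a" "\<And>z. z * a = a * z \<Longrightarrow> z * p = p * z"
    using cstar_positive_sqrt_exists[OF assms] by metis
  have uniq: "q = p" if "cstar_positive q" "q * q = a" for q
  proof (rule cstar_sqrt_unique[OF p(1) that(1)])
    show "p * p = q * q"
      by (simp only: p(2) that(2))
    show "q * p = p * q"
      by (rule p(3)) (simp only: that(2)[symmetric] mult.assoc)
  qed
  have "\<exists>!p. cstar_positive p \<and> p * p = a"
    by (rule ex1I[of _ p]) (rule conjI[OF p(1,2)], elim conjE, rule uniq)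
  then have "cstar_positive (cstar_sqrt a) \<and> cstar_sqrt a * cstar_sqrt a = a"
    unfolding cstar_sqrt_def by (rule theI')
  then show "cstar_positive (cstar_sqrt a)" "cstar_sqrt a * cstar_sqrt a = a"
    by auto
qed

text \<open>The C*-identity gives \<open>cstar_abs T\<close> the same norm as \<open>T\<close>, so
  an order bound by a scalar reduces to a norm estimate.\<close>

lemma cstar_abs_le_norm:
  fixes T :: "'a::unital_cstar_algebra"
  assumes "norm T \<le> k"
  shows "cstar_abs T \<preceq> scalar (complex_of_real k)"
proof -
  have p: "cstar_positive (cstar_abs T)" "cstar_abs T * cstar_abs T = star T * T"
    unfolding cstar_abs_def using cstar_sqrt[OF cstar_positive_star_mult_self[of T]] by auto
  then have "(norm (cstar_abs T))\<^sup>2 = (norm T)\<^sup>2"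
    using norm_selfadjoint_square[of "cstar_abs T"] norm_star_mult_self[of T]
    by (simp add: cstar_positive_def)
  then have "norm (cstar_abs T) \<le> k"
    using assms by simp
  then show ?thesis
    using p(1) norm_scaleR_one_minus_positive
    by (auto simp: cstar_le_def cstar_positive_def scalar_of_real selfadjoint_scaleR)
qed

section \<open>Left multipliers\<close>

lemma cstar_positive_conjugate:
  fixes a z :: "'a::unital_cstar_algebra"
  assumes "cstar_positive a"
  shows "cstar_positive (star z * a * z)"
proof -
  have "star (cstar_sqrt a * z) * (cstar_sqrt a * z) = star z * (cstar_sqrt a * cstar_sqrt a) * z"
    using cstar_sqrt(1)[OF assms]
    by (simp add: star_mult cstar_positive_def selfadjoint_def mult.assoc)
  then show ?thesis
    using cstar_positive_star_mult_self[of "cstar_sqrt a * z"] by (simp add: cstar_sqrt(2)[OF assms])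
qed

lemma positive_linear_mapD:
  assumes "positive_linear_map \<Phi>"
  shows positive_linear_map_add: "\<Phi> (x + y) = \<Phi> x + \<Phi> y"
    and positive_linear_map_diff: "\<Phi> (x - y) = \<Phi> x - \<Phi> y"
    and positive_linear_map_scaleC: "\<Phi> (c *\<^sub>C x) = c *\<^sub>C \<Phi> x"
    and positive_linear_map_scaleR: "\<Phi> (r *\<^sub>R x) = r *\<^sub>R \<Phi> x"
    and positive_linear_map_positive: "cstar_positive x \<Longrightarrow> cstar_positive (\<Phi> x)"
proof -
  have hom: "module_hom (*\<^sub>C) (*\<^sub>C) \<Phi>"
    using assms by (simp add: positive_linear_map_def Vector_Spaces.linear_def)
  show "\<Phi> (x + y) = \<Phi> x + \<Phi> y" "\<Phi> (x - y) = \<Phi> x - \<Phi> y" "\<Phi> (c *\<^sub>C x) = c *\<^sub>C \<Phi> x"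
    by (rule module_hom.add[OF hom] module_hom.diff[OF hom] module_hom.scale[OF hom])+
  show "\<Phi> (r *\<^sub>R x) = r *\<^sub>R \<Phi> x"
    unfolding scaleR_scaleC by (rule module_hom.scale[OF hom])
  show "cstar_positive x \<Longrightarrow> cstar_positive (\<Phi> x)"
    using assms by (simp add: positive_linear_map_def)
qed

text \<open>A self-adjoint \<open>x\<close> is the difference of the positive elements
  \<open>norm x *\<^sub>R 1\<close> and \<open>norm x *\<^sub>R 1 - x\<close>.\<close>

lemma positive_linear_map_selfadjoint:
  assumes \<Phi>: "positive_linear_map \<Phi>" and x: "selfadjoint x"
  shows "selfadjoint (\<Phi> x)"
proof -
  have "cstar_positive (\<Phi> (norm x *\<^sub>R 1))" "cstar_positive (\<Phi> (norm x *\<^sub>R 1 - x))"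
    by (intro positive_linear_map_positive[OF \<Phi>] cstar_positive_scaleR_one norm_ge_zero
        norm_scaleR_one_minus_positive[OF x] order_refl)+
  then have "selfadjoint (\<Phi> (norm x *\<^sub>R 1) - \<Phi> (norm x *\<^sub>R 1 - x))"
    by (intro selfadjoint_diff) (auto simp: cstar_positive_def)
  then show ?thesis
    by (simp flip: positive_linear_map_diff[OF \<Phi>])
qed

lemma cartesian_decomposition:
  fixes x :: "'a::cstar_algebra"
  obtains h k where "selfadjoint h" "selfadjoint k" "x = h + \<i> *\<^sub>C k"
proof
  show "selfadjoint (Re_part x)"
    by (simp add: selfadjoint_def Re_part_def star_scaleC star_add star_star add.commute)
  show "selfadjoint ((- \<i> / 2) *\<^sub>C (x - star x))"
    by (simp add: selfadjoint_def star_scaleC star_diff star_star scaleC_diff_right)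
  have "Re_part x + \<i> *\<^sub>C ((- \<i> / 2) *\<^sub>C (x - star x)) = (1/2 + 1/2) *\<^sub>C x"
    unfolding scaleC_add_left by (simp add: Re_part_def scaleC_scaleC scaleC_add_right scaleC_diff_right)
  then show "x = Re_part x + \<i> *\<^sub>C ((- \<i> / 2) *\<^sub>C (x - star x))"
    by simp
qed

lemma positive_linear_map_star:
  assumes \<Phi>: "positive_linear_map \<Phi>"
  shows "\<Phi> (star x) = star (\<Phi> x)"
proof -
  obtain h k where "selfadjoint h" "selfadjoint k" and x: "x = h + \<i> *\<^sub>C k"
    by (rule cartesian_decomposition)
  then have "star h = h" "star k = k" "star (\<Phi> h) = \<Phi> h" "star (\<Phi> k) = \<Phi> k"
    using positive_linear_map_selfadjoint[OF \<Phi>] by (auto simp: selfadjoint_def)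
  then show ?thesis
    by (simp add: x star_add star_scaleC positive_linear_map_add[OF \<Phi>]
        positive_linear_map_diff[OF \<Phi>] positive_linear_map_scaleC[OF \<Phi>])
qed

lemma left_multiplierD:
  assumes "left_multiplier S \<Phi>"
  shows "positive_linear_map \<Phi>" "\<Phi> x \<in> S" "y \<in> S \<Longrightarrow> \<Phi> (x * y) = \<Phi> x * y"
  using assms by (auto simp: left_multiplier_def)

text \<open>The adjoint of the multiplier identity, since \<Phi> commutes with \<open>star\<close>;
  it lets adjoints of elements of \<open>S\<close> leave \<Phi> on the left.\<close>

lemma left_multiplier_star_mult:
  assumes "left_multiplier S \<Phi>" "y \<in> S"
  shows "\<Phi> (star y * x) = star y * \<Phi> x"
proof -
  have "\<Phi> (star y * x) = star (\<Phi> (star x * y))"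
    by (simp add: star_mult star_star flip: positive_linear_map_star[OF left_multiplierD(1)[OF assms(1)]])
  also have "\<dots> = star y * \<Phi> x"
    by (simp add: left_multiplierD(3)[OF assms] star_mult star_star
        positive_linear_map_star[OF left_multiplierD(1)[OF assms(1)]])
  finally show ?thesis .
qed

lemma left_multiplier_fixes:
  assumes "left_multiplier S \<Phi>" "\<Phi> 1 = 1" "y \<in> S"
  shows "\<Phi> y = y"
  using left_multiplierD(3)[OF assms(1,3), of 1] assms(2) by simp

text \<open>As in an inner product module over \<open>S\<close>: the value \<open>T\<close> lies in
  \<open>S\<close> and can be taken out of \<Phi> on either side when the square of a combination of
  \<open>X\<close> and \<open>Y\<close> is expanded.\<close>

lemma left_multiplier_Cauchy_Schwarz:
  fixes X Y :: "'a::unital_cstar_algebra"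
  assumes \<Phi>: "left_multiplier S \<Phi>" and t: "t > 0"
    and X: "cstar_positive (t *\<^sub>R 1 - \<Phi> (star X * X))"
  defines "T \<equiv> \<Phi> (star X * Y)"
  shows "cstar_positive (t *\<^sub>R \<Phi> (star Y * Y) - star T * T)"
proof -
  note lin = left_multiplierD(1)[OF \<Phi>]
  have T: "T \<in> S"
    by (simp add: T_def left_multiplierD(2)[OF \<Phi>])
  have T': "star T = \<Phi> (star Y * X)"
    by (simp add: T_def star_mult star_star flip: positive_linear_map_star[OF lin])
  \<comment> \<open>Up to the factor \<open>- t\<close>, this is \<open>Y\<close> minus its
    projection along \<open>X\<close>, with the upper bound \<open>t\<close> in place of
    \<open>\<Phi> (star X * X)\<close>; the resulting slack is the conjugated term added
    below.\<close>
  define Z where "Z = X * T - t *\<^sub>R Y"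
  have "star Z * Z = star T * (star X * X * T) - t *\<^sub>R (star T * (star X * Y))
      - t *\<^sub>R (star Y * X * T) + (t * t) *\<^sub>R (star Y * Y)"
    by (simp add: Z_def star_diff star_mult star_scaleR algebra_simps)
  then have "\<Phi> (star Z * Z) = star T * (\<Phi> (star X * X) * T) - t *\<^sub>R (star T * T)
      - t *\<^sub>R (star T * T) + (t * t) *\<^sub>R \<Phi> (star Y * Y)"
    by (simp only: positive_linear_mapD[OF lin] left_multiplier_star_mult[OF \<Phi> T]
        left_multiplierD(3)[OF \<Phi> T] T_def[symmetric] T'[symmetric])
  moreover have "star T * (t *\<^sub>R 1 - \<Phi> (star X * X)) * T
      = t *\<^sub>R (star T * T) - star T * (\<Phi> (star X * X) * T)"
    by (simp add: algebra_simps)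
  ultimately have "\<Phi> (star Z * Z) + star T * (t *\<^sub>R 1 - \<Phi> (star X * X)) * T
      = t *\<^sub>R (t *\<^sub>R \<Phi> (star Y * Y) - star T * T)"
    by (simp add: scaleR_diff_right)
  moreover have "cstar_positive (\<Phi> (star Z * Z) + star T * (t *\<^sub>R 1 - \<Phi> (star X * X)) * T)"
    by (intro cstar_positive_add cstar_positive_conjugate X positive_linear_map_positive[OF lin]
        cstar_positive_star_mult_self)
  ultimately have "cstar_positive (inverse t *\<^sub>R (t *\<^sub>R (t *\<^sub>R \<Phi> (star Y * Y) - star T * T)))"
    using t by (intro cstar_positive_scaleR[where r = "inverse t"]) simp_all
  then show ?thesis
    using t by simp
qed

lemma left_multiplier_norm_Cauchy_Schwarz:
  assumes \<Phi>: "left_multiplier S \<Phi>" and "r \<ge> 0" "s \<ge> 0"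
    and X: "cstar_positive (r *\<^sub>R 1 - \<Phi> (star X * X))"
    and Y: "cstar_positive (s *\<^sub>R 1 - \<Phi> (star Y * Y))"
  shows "(norm (\<Phi> (star X * Y)))\<^sup>2 \<le> r * s"
proof (rule field_le_epsilon)
  fix e :: real
  assume e: "e > 0"
  \<comment> \<open>Enlarging \<open>r\<close> to \<open>r + d\<close> supplies the positive bound
    that the operator inequality requires, even if \<open>r = 0\<close>; dividing by
    \<open>s + 1\<close> gives \<open>d * s \<le> e\<close> and allows \<open>s = 0\<close>.\<close>
  define d where "d = e / (s + 1)"
  have d: "d > 0" "d * s \<le> e"
    using e \<open>s \<ge> 0\<close> by (auto simp: d_def field_simps)
  define T where "T = \<Phi> (star X * Y)"
  have "cstar_positive ((r *\<^sub>R 1 - \<Phi> (star X * X)) + d *\<^sub>R 1)"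
    using d by (intro cstar_positive_add X cstar_positive_scaleR_one) simp
  then have "cstar_positive ((r + d) *\<^sub>R 1 - \<Phi> (star X * X))"
    by (simp add: algebra_simps)
  then have "cstar_positive ((r + d) *\<^sub>R \<Phi> (star Y * Y) - star T * T)"
    unfolding T_def using d \<open>r \<ge> 0\<close> by (intro left_multiplier_Cauchy_Schwarz[OF \<Phi>]) auto
  moreover have "cstar_positive ((r + d) *\<^sub>R (s *\<^sub>R 1 - \<Phi> (star Y * Y)))"
    using d \<open>r \<ge> 0\<close> by (intro cstar_positive_scaleR Y) simp
  ultimately have "cstar_positive (((r + d) *\<^sub>R \<Phi> (star Y * Y) - star T * T)
      + (r + d) *\<^sub>R (s *\<^sub>R 1 - \<Phi> (star Y * Y)))"
    by (rule cstar_positive_add)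
  then have "cstar_positive (((r + d) * s) *\<^sub>R 1 - star T * T)"
    by (simp add: scaleR_diff_right)
  then have "norm (star T * T) \<le> (r + d) * s"
    using d assms(2,3) by (intro cstar_positive_bounded_norm cstar_positive_star_mult_self) auto
  then show "(norm (\<Phi> (star X * Y)))\<^sup>2 \<le> r * s + e"
    using d(2) by (simp add: norm_star_mult_self T_def algebra_simps)
qed

section \<open>Covariance and variance bounds\<close>

lemma left_multiplier_covariance:
  assumes \<Phi>: "left_multiplier S \<Phi>" "\<Phi> 1 = 1"
  shows "\<Phi> (star (X - \<Phi> X) * (Y - \<Phi> Y)) = \<Phi> (star X * Y) - star (\<Phi> X) * \<Phi> Y"
proof -
  note lin = left_multiplierD(1)[OF \<Phi>(1)]
  have S': "\<Phi> X \<in> S" "\<Phi> Y \<in> S"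
    by (rule left_multiplierD(2)[OF \<Phi>(1)])+
  have "star (X - \<Phi> X) * (Y - \<Phi> Y)
      = star X * Y - star X * \<Phi> Y - star (\<Phi> X) * Y + star (\<Phi> X) * \<Phi> Y"
    by (simp add: star_diff algebra_simps)
  \<comment> \<open>Under \<Phi> both cross terms and the last term become
    \<open>star (\<Phi> X) * \<Phi> Y\<close>, with signs that leave one copy subtracted.\<close>
  then show ?thesis
    by (simp add: positive_linear_mapD[OF lin] left_multiplier_star_mult[OF \<Phi>(1) S'(1)]
        left_multiplierD(3)[OF \<Phi>(1) S'(2)] positive_linear_map_star[OF lin]
        left_multiplier_fixes[OF \<Phi> S'(1)] left_multiplier_fixes[OF \<Phi> S'(2)])
qed

text \<open>In terms of the centre \<open>(M + m) / 2\<close> and the half-difference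
  \<open>d\<close>, the product is \<open>star (scalar d - D) * (D + scalar d)\<close>; its mixed
  terms form a skew-adjoint element and disappear from the real part.\<close>

lemma Re_part_disc_condition:
  fixes A :: "'a::unital_cstar_algebra"
  shows "Re_part (star (scalar M - A) * (A - scalar m)) = (cmod (M - m) / 2)\<^sup>2 *\<^sub>R 1
    - star (A - scalar ((M + m) / 2)) * (A - scalar ((M + m) / 2))"
proof -
  define d where "d = (M - m) / 2"
  define D where "D = A - scalar ((M + m) / 2)"
  have M: "M = (M + m) / 2 + d" and m: "m = (M + m) / 2 - d"
    by (simp_all add: d_def field_simps)
  have "scalar M - A = scalar d - D" "A - scalar m = D + scalar d"
    by (simp add: D_def, subst M, simp only: scalar_add, simp)
      (simp add: D_def, subst m, simp only: scalar_diff, simp)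
  then have P: "star (scalar M - A) * (A - scalar m)
      = cnj d *\<^sub>C D + scalar (cnj d * d) - star D * D - d *\<^sub>C star D"
    by (simp add: star_diff star_scalar algebra_simps scalar_mult scalar_mult_left scalar_mult_right
        scaleC_diff_right) (simp add: scalar_def scaleC_scaleC mult.commute)
  have "star (cnj d *\<^sub>C D + scalar (cnj d * d) - star D * D - d *\<^sub>C star D)
      = d *\<^sub>C star D + scalar (cnj d * d) - star D * D - cnj d *\<^sub>C D"
    by (simp add: star_diff star_add star_scaleC star_scalar star_mult star_star mult.commute)
  then have "Re_part (star (scalar M - A) * (A - scalar m))
      = (1/2) *\<^sub>C (2 *\<^sub>R (scalar (cnj d * d) - star D * D))"
    unfolding Re_part_def P by (simp add: scaleR_2)
  also have "\<dots> = scalar (cnj d * d) - star D * D"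
    by (simp add: scaleR_scaleC scaleC_scaleC)
  also have "cnj d * d = complex_of_real ((cmod (M - m) / 2)\<^sup>2)"
  proof -
    have "cmod d = cmod (M - m) / 2"
      by (simp add: d_def norm_divide)
    then show ?thesis
      by (metis complex_norm_square mult.commute)
  qed
  finally show ?thesis
    unfolding scalar_of_real D_def .
qed

text \<open>Since \<Phi> fixes scalars, \<open>A\<close> and its shift \<open>D\<close> have the
  same centred element. The variance is then \<open>\<Phi> (star D * D)\<close> minus the positive
  element \<open>star (\<Phi> D) * \<Phi> D\<close>, and \<Phi> preserves the disc bound on
  \<open>star D * D\<close>.\<close>

lemma left_multiplier_variance_bound:
  fixes A :: "'a::unital_cstar_algebra"
  assumes \<Phi>: "left_multiplier S \<Phi>" "\<Phi> 1 = 1"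
    and A: "0 \<preceq> Re_part (star (scalar M - A) * (A - scalar m))"
  shows "cstar_positive ((cmod (M - m) / 2)\<^sup>2 *\<^sub>R 1 - \<Phi> (star (A - \<Phi> A) * (A - \<Phi> A)))"
proof -
  note lin = left_multiplierD(1)[OF \<Phi>(1)]
  define D where "D = A - scalar ((M + m) / 2)"
  define k where "k = (cmod (M - m) / 2)\<^sup>2"
  have "\<Phi> (scalar c) = scalar c" for c
    by (simp add: scalar_def positive_linear_map_scaleC[OF lin] \<Phi>(2))
  then have "D - \<Phi> D = A - \<Phi> A"
    by (simp add: D_def positive_linear_map_diff[OF lin])
  then have var: "\<Phi> (star (A - \<Phi> A) * (A - \<Phi> A)) = \<Phi> (star D * D) - star (\<Phi> D) * \<Phi> D"
    using left_multiplier_covariance[OF \<Phi>, of D D] by simp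
  have "cstar_positive (k *\<^sub>R 1 - star D * D)"
    using A by (simp add: cstar_le_def Re_part_disc_condition D_def k_def)
  then have "cstar_positive (k *\<^sub>R 1 - \<Phi> (star D * D))"
    using positive_linear_map_positive[OF lin]
    by (metis positive_linear_map_diff[OF lin] positive_linear_map_scaleR[OF lin] \<Phi>(2))
  then have "cstar_positive (k *\<^sub>R 1 - \<Phi> (star D * D) + star (\<Phi> D) * \<Phi> D)"
    by (intro cstar_positive_add cstar_positive_star_mult_self)
  then show ?thesis
    by (simp only: var k_def[symmetric] diff_diff_eq2 diff_add_eq)
qed

theorem theorem4p4:
  fixes \<B> :: "'a::unital_cstar_algebra set"
    and \<Phi> :: "'a \<Rightarrow> 'a"
    and A B :: 'a
    and M1 m1 M2 m2 :: complex
  assumes "cstar_subalgebra \<B>" and "1 \<in> \<B>"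
    and "left_multiplier \<B> \<Phi>" and "\<Phi> 1 = 1"
    and "0 \<preceq> Re_part (star (scalar M1 - A) * (A - scalar m1))"
    and "0 \<preceq> Re_part (star (scalar M2 - B) * (B - scalar m2))"
  shows "cstar_abs (\<Phi> (star A * B) - star (\<Phi> A) * \<Phi> B)
           \<preceq> scalar (complex_of_real (1/4 * cmod (M1 - m1) * cmod (M2 - m2)))"
proof (rule cstar_abs_le_norm)
  \<comment> \<open>The norm form of Cauchy-Schwarz at the centred elements, with the two squared
    radii as bounds on the variances.\<close>
  have "(norm (\<Phi> (star (A - \<Phi> A) * (B - \<Phi> B))))\<^sup>2
      \<le> (cmod (M1 - m1) / 2)\<^sup>2 * (cmod (M2 - m2) / 2)\<^sup>2"
    by (intro left_multiplier_norm_Cauchy_Schwarz[OF assms(3)]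
        left_multiplier_variance_bound[OF assms(3,4)] assms(5,6) zero_le_power2)
  also have "\<dots> = (1/4 * cmod (M1 - m1) * cmod (M2 - m2))\<^sup>2"
    by (simp add: power2_eq_square)
  finally have "norm (\<Phi> (star (A - \<Phi> A) * (B - \<Phi> B))) \<le> 1/4 * cmod (M1 - m1) * cmod (M2 - m2)"
    by (rule power2_le_imp_le) simp
  then show "norm (\<Phi> (star A * B) - star (\<Phi> A) * \<Phi> B) \<le> 1/4 * cmod (M1 - m1) * cmod (M2 - m2)"
    by (simp only: left_multiplier_covariance[OF assms(3,4)])
qed

end
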